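(* Let $\mathcal{X}$ be a Higmanian scheme (in the sense defined in the context) with parameters $(f,m,n,k,t)$, $f,m,n\ge 2$. Then $\mathcal{X}$ is Q-Higmanian if and only if, for one choice of the sign $\pm$, $$t=\frac{k(f-2)}{mn}\left(mn-k\pm \sqrt{\frac{k(mn-k)}{m(n-1)}}\right).$$
   Context: An (association) scheme $\mathcal{X}$ on a finite set $\Omega$, $|\Omega|=v$, is given by a partition of $\Omega\times\Omega$ into basic relations $R_0,\dots,R_d$ ($R_0$ the diagonal), closed under inverses, with intersection numbers $p_{RS}^T$; it is symmetric if every basic relation equals its inverse. A parabolic is an equivalence relation on $\Omega$ that is a union of basic relations; $\Omega/E$ denotes its set of classes, $n_E$ the common class size; $n_R$ is the valency of a relation $R$. $\mathcal{X}$ is imprimitive if it has a parabolic other than the diagonal and $\Omega\times\Omega$, indecomposable if it is not a wreath product. A Higmanian scheme here means an imprimitive, symmetric, indecomposable scheme of rank $5$ having exactly two proper nontrivial parabolics $E\subsetneq F$. With $S,T$ the two basic relations not contained in $F$, labelled so that $n_T\le n_S$, its parameters are $f=|\Omega|/n_F$, $m=n_F/n_E$, $n=n_E$, $k=|\{\beta\in\Delta:(\alpha,\beta)\in S\}|$ for $\alpha\in\Omega$ and $\Delta\in\Omega/F$ not containing $\alpha$ (independent of choices), and $t=p_{TS}^T$. For a commutative scheme with primitive idempotents $E_0,\dots,E_d$ of its adjacency (Bose–Mesner) algebra, where $E_0=\frac1vJ$, let $m_i=\mathrm{rank}(E_i)$ and define the Krein parameters $q_{ij}^k$ by $E_i\circ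 E_j=\frac1v\sum_k q_{ij}^kE_k$ ($\circ$ the entrywise product). Let $I_0=\{0,\dots,d\}$ and let $\mathcal{I}$ be the set of $I\subseteq I_0$ such that $\langle E_i:i\in I\rangle$ is a proper nontrivial $\circ$-subalgebra of the adjacency algebra; to each such $I$ corresponds a parabolic $E(I)$, namely the one for which $\langle E_i:i\in I\rangle$ consists of the matrices of the adjacency algebra that are constant on each block $\Delta\times\Gamma$, $\Delta,\Gamma\in\Omega/E(I)$. For $I\in\mathcal{I}$ define $i\sim_I j$ iff $q_{ij}^k\ne0$ for some $k\in I$; this is an equivalence relation on $I_0$. The scheme is Q-Higmanian if there are an ordering $E_0,E_1,\dots,E_d$ of the primitive idempotents (with $E_0=\frac1vJ$) and $l\in\{1,\dots,d/2\}$ such that: (1) $I=\{0,d\}\in\mathcal{I}$; (2) the equivalence classes of $\sim_I$ are $\{i,d-i\}$ for $i\in\{0,\dots,l-1\}$ and $\{i\}$ for $i\in\{l,\dots,d-l\}$; (3) $m_{d-i}=(f'-1)m_i$ for $i\in\{0,\dots,l-1\}$, where $f'=|\Omega/E(I)|$. *)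

theory Defs
  imports "HOL-Analysis.Analysis" "HOL-Library.Disjoint_Sets"
begin

section \<open>Association schemes\<close>

definition association_scheme :: "'a set \<Rightarrow> ('a \<times> 'a) set set \<Rightarrow> bool" where
  "association_scheme \<Omega> X \<longleftrightarrow>
     finite \<Omega> \<and>
     partition_on (\<Omega> \<times> \<Omega>) X \<and>
     Id_on \<Omega> \<in> X \<and>
     (\<forall>R\<in>X. converse R \<in> X) \<and>
     (\<forall>R\<in>X. \<forall>S\<in>X. \<forall>T\<in>X. \<exists>p::nat. \<forall>(\<alpha>, \<beta>)\<in>T.
        card {\<gamma>. (\<alpha>, \<gamma>) \<in> R \<and> (\<gamma>, \<beta>) \<in> S} = p)"

text \<open>\<open>intersection_number R S T\<close> is $p_{RS}^T$.\<close>

definition intersection_number ::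
    "('a \<times> 'a) set \<Rightarrow> ('a \<times> 'a) set \<Rightarrow> ('a \<times> 'a) set \<Rightarrow> nat" where
  "intersection_number R S T =
     (THE p. \<forall>(\<alpha>, \<beta>)\<in>T. card {\<gamma>. (\<alpha>, \<gamma>) \<in> R \<and> (\<gamma>, \<beta>) \<in> S} = p)"

definition valency :: "'a set \<Rightarrow> ('a \<times> 'a) set \<Rightarrow> nat" where
  "valency \<Omega> R = (THE n. \<forall>\<alpha>\<in>\<Omega>. card (R `` {\<alpha>}) = n)"

definition symmetric_scheme :: "'a set \<Rightarrow> ('a \<times> 'a) set set \<Rightarrow> bool" where
  "symmetric_scheme \<Omega> X \<longleftrightarrow> association_scheme \<Omega> X \<and> (\<forall>R\<in>X. converse R = R)"

definition commutative_scheme :: "'a set \<Rightarrow> ('a \<times> 'a) set set \<Rightarrow> bool" where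
  "commutative_scheme \<Omega> X \<longleftrightarrow> association_scheme \<Omega> X \<and>
     (\<forall>R\<in>X. \<forall>S\<in>X. \<forall>T\<in>X. intersection_number R S T = intersection_number S R T)"

definition parabolic :: "'a set \<Rightarrow> ('a \<times> 'a) set set \<Rightarrow> ('a \<times> 'a) set \<Rightarrow> bool" where
  "parabolic \<Omega> X P \<longleftrightarrow> equiv \<Omega> P \<and> (\<exists>Y\<subseteq>X. P = \<Union>Y)"

definition proper_nontrivial_parabolic ::
    "'a set \<Rightarrow> ('a \<times> 'a) set set \<Rightarrow> ('a \<times> 'a) set \<Rightarrow> bool" where
  "proper_nontrivial_parabolic \<Omega> X P \<longleftrightarrow>
     parabolic \<Omega> X P \<and> P \<noteq> Id_on \<Omega> \<and> P \<noteq> \<Omega> \<times> \<Omega>"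

definition imprimitive :: "'a set \<Rightarrow> ('a \<times> 'a) set set \<Rightarrow> bool" where
  "imprimitive \<Omega> X \<longleftrightarrow> (\<exists>P. proper_nontrivial_parabolic \<Omega> X P)"

text \<open>The wreath product of a scheme \<open>Y\<close> on \<open>\<Delta>\<close> (the scheme inside each fibre) with a
  scheme \<open>Z\<close> on \<open>\<Gamma>\<close> (the scheme on the set of fibres).\<close>

definition wreath_product ::
    "'b set \<Rightarrow> ('b \<times> 'b) set set \<Rightarrow> 'c set \<Rightarrow> ('c \<times> 'c) set set \<Rightarrow>
     (('b \<times> 'c) \<times> ('b \<times> 'c)) set set" where
  "wreath_product \<Delta> Y \<Gamma> Z =
     (\<lambda>R. {((a, x), (b, x)) | a b x. (a, b) \<in> R \<and> x \<in> \<Gamma>}) ` Y \<union>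
     (\<lambda>S. {((a, x), (b, y)) | a b x y. a \<in> \<Delta> \<and> b \<in> \<Delta> \<and> (x, y) \<in> S}) ` (Z - {Id_on \<Gamma>})"

text \<open>Up to isomorphism, the factors may be taken on subsets of the ambient type, since their
  degrees divide \<open>card \<Omega>\<close>. Factors of degree one are excluded, because every scheme is a wreath
  product with the scheme on one point.\<close>

definition decomposable :: "'a set \<Rightarrow> ('a \<times> 'a) set set \<Rightarrow> bool" where
  "decomposable \<Omega> X \<longleftrightarrow>
     (\<exists>(\<Delta> :: 'a set) Y (\<Gamma> :: 'a set) Z \<phi>.
        association_scheme \<Delta> Y \<and> association_scheme \<Gamma> Z \<and>
        card \<Delta> \<ge> 2 \<and> card \<Gamma> \<ge> 2 \<and>
        bij_betw \<phi> (\<Delta> \<times> \<Gamma>) \<Omega> \<and>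
        X = (\<lambda>R. map_prod \<phi> \<phi> ` R) ` wreath_product \<Delta> Y \<Gamma> Z)"

section \<open>Higmanian schemes\<close>

definition higmanian :: "'a set \<Rightarrow> ('a \<times> 'a) set set \<Rightarrow> bool" where
  "higmanian \<Omega> X \<longleftrightarrow>
     symmetric_scheme \<Omega> X \<and> imprimitive \<Omega> X \<and> \<not> decomposable \<Omega> X \<and> card X = 5 \<and>
     (\<exists>E F. E \<subset> F \<and> {P. proper_nontrivial_parabolic \<Omega> X P} = {E, F})"

text \<open>If \<open>valency \<Omega> S = valency \<Omega> T\<close>, both labellings of the two basic relations outside \<open>F\<close>
  are admitted.\<close>

definition higmanian_parameters ::
    "'a set \<Rightarrow> ('a \<times> 'a) set set \<Rightarrow> nat \<Rightarrow> nat \<Rightarrow> nat \<Rightarrow> nat \<Rightarrow> nat \<Rightarrow> bool" where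
  "higmanian_parameters \<Omega> X f m n k t \<longleftrightarrow>
     (\<exists>E F S T.
        E \<subset> F \<and> {P. proper_nontrivial_parabolic \<Omega> X P} = {E, F} \<and>
        S \<noteq> T \<and> {R \<in> X. \<not> R \<subseteq> F} = {S, T} \<and> valency \<Omega> T \<le> valency \<Omega> S \<and>
        real f = real (card \<Omega>) / real (valency \<Omega> F) \<and>
        real m = real (valency \<Omega> F) / real (valency \<Omega> E) \<and>
        n = valency \<Omega> E \<and>
        k = (THE k. \<forall>\<alpha>\<in>\<Omega>. \<forall>\<Delta>\<in>\<Omega> // F. \<alpha> \<notin> \<Delta> \<longrightarrow> card {\<beta>\<in>\<Delta>. (\<alpha>, \<beta>) \<in> S} = k) \<and>
        t = intersection_number T S T)"

section \<open>The adjacency algebra\<close>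

text \<open>From here on, the point set is the whole of a finite type.\<close>

definition mat_scale :: "complex \<Rightarrow> complex^'n^'n \<Rightarrow> complex^'n^'n" where
  "mat_scale c A = (\<chi> i j. c * A $ i $ j)"

interpretation cmat: vector_space "mat_scale :: complex \<Rightarrow> complex^'n^'n \<Rightarrow> complex^'n^'n"
  by unfold_locales (simp_all add: mat_scale_def vec_eq_iff algebra_simps)

definition hadamard :: "complex^'n^'n \<Rightarrow> complex^'n^'n \<Rightarrow> complex^'n^'n" where
  "hadamard A B = (\<chi> i j. A $ i $ j * B $ i $ j)"

definition all_ones :: "complex^'n^'n" where
  "all_ones = (\<chi> i j. 1)"

definition adjacency_matrix :: "('n \<times> 'n) set \<Rightarrow> complex^'n^'n" where
  "adjacency_matrix R = (\<chi> i j. if (i, j) \<in> R then 1 else 0)"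

definition adjacency_algebra :: "('n::finite \<times> 'n) set set \<Rightarrow> (complex^'n^'n) set" where
  "adjacency_algebra X = cmat.span (adjacency_matrix ` X)"

definition primitive_idempotents :: "('n::finite \<times> 'n) set set \<Rightarrow> (complex^'n^'n) set" where
  "primitive_idempotents X =
     {P \<in> adjacency_algebra X. P \<noteq> 0 \<and> P ** P = P \<and>
        (\<forall>Q\<in>adjacency_algebra X. Q ** Q = Q \<and> P ** Q = Q \<and> Q ** P = Q \<longrightarrow> Q = 0 \<or> Q = P)}"

text \<open>\<open>idempotent_ordering X d Es\<close>: the primitive idempotents are
  \<open>Es 0, \<dots>, Es d\<close> without repetition, where \<open>d + 1\<close> is the rank of the scheme.\<close>

definition idempotent_ordering ::
    "('n::finite \<times> 'n) set set \<Rightarrow> nat \<Rightarrow> (nat \<Rightarrow> complex^'n^'n) \<Rightarrow> bool" where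
  "idempotent_ordering X d Es \<longleftrightarrow>
     card X = d + 1 \<and> bij_betw Es {..d} (primitive_idempotents X) \<and>
     Es 0 = mat_scale (1 / of_nat CARD('n)) all_ones"

text \<open>\<open>krein d Es i j k\<close> is $q_{ij}^k$; the values at \<open>k > d\<close> are set to 0 to make the
  coefficient function unique.\<close>

definition krein ::
    "nat \<Rightarrow> (nat \<Rightarrow> complex^'n::finite^'n) \<Rightarrow> nat \<Rightarrow> nat \<Rightarrow> nat \<Rightarrow> complex" where
  "krein d Es i j = (THE q. (\<forall>k>d. q k = 0) \<and>
     hadamard (Es i) (Es j) =
       mat_scale (1 / of_nat CARD('n)) (\<Sum>k\<le>d. mat_scale (q k) (Es k)))"

definition hadamard_subalgebra ::
    "('n::finite \<times> 'n) set set \<Rightarrow> (complex^'n^'n) set \<Rightarrow> bool" where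
  "hadamard_subalgebra X W \<longleftrightarrow>
     cmat.subspace W \<and> W \<subseteq> adjacency_algebra X \<and> all_ones \<in> W \<and>
     (\<forall>A\<in>W. \<forall>B\<in>W. hadamard A B \<in> W)"

text \<open>The set $\mathcal{I}$. The trivial subalgebra is the one spanned by the identity
  \<open>all_ones\<close> of the entrywise product.\<close>

definition index_sets ::
    "('n::finite \<times> 'n) set set \<Rightarrow> nat \<Rightarrow> (nat \<Rightarrow> complex^'n^'n) \<Rightarrow> nat set set" where
  "index_sets X d Es =
     {I. I \<subseteq> {..d} \<and> hadamard_subalgebra X (cmat.span (Es ` I)) \<and>
        cmat.span (Es ` I) \<noteq> cmat.span {all_ones} \<and>
        cmat.span (Es ` I) \<noteq> adjacency_algebra X}"

definition constant_on_blocks :: "('n \<times> 'n) set \<Rightarrow> complex^'n^'n \<Rightarrow> bool" where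
  "constant_on_blocks P A \<longleftrightarrow>
     (\<forall>\<Delta>\<in>UNIV // P. \<forall>\<Gamma>\<in>UNIV // P. \<forall>\<alpha>\<in>\<Delta>. \<forall>\<alpha>'\<in>\<Delta>. \<forall>\<beta>\<in>\<Gamma>. \<forall>\<beta>'\<in>\<Gamma>.
        A $ \<alpha> $ \<beta> = A $ \<alpha>' $ \<beta>')"

definition index_parabolic ::
    "('n::finite \<times> 'n) set set \<Rightarrow> (nat \<Rightarrow> complex^'n^'n) \<Rightarrow> nat set \<Rightarrow> ('n \<times> 'n) set" where
  "index_parabolic X Es I = (THE P. parabolic UNIV X P \<and>
     cmat.span (Es ` I) = {A \<in> adjacency_algebra X. constant_on_blocks P A})"

definition index_relation ::
    "nat \<Rightarrow> (nat \<Rightarrow> complex^'n::finite^'n) \<Rightarrow> nat set \<Rightarrow> (nat \<times> nat) set" where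
  "index_relation d Es I =
     {(i, j). i \<le> d \<and> j \<le> d \<and> (\<exists>k\<in>I. krein d Es i j k \<noteq> 0)}"

section \<open>Q-Higmanian schemes\<close>

definition Q_higmanian :: "('n::finite \<times> 'n) set set \<Rightarrow> bool" where
  "Q_higmanian X \<longleftrightarrow> commutative_scheme UNIV X \<and>
     (\<exists>d Es l. idempotent_ordering X d Es \<and> 1 \<le> l \<and> 2 * l \<le> d \<and>
        {0, d} \<in> index_sets X d Es \<and>
        {..d} // index_relation d Es {0, d} =
          {{i, d - i} | i. i < l} \<union> {{i} | i. l \<le> i \<and> i \<le> d - l} \<and>
        (\<forall>i<l. int (rank (Es (d - i))) =
          (int (card (UNIV // index_parabolic X Es {0, d})) - 1) * int (rank (Es i))))"

end

theory Submission
  imports Defs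
begin

text \<open>
  Let \<open>E \<subset> F\<close> be the two parabolics and write \<open>B\<^sub>P = A\<^sub>P / n\<^sub>P\<close> for the averaging matrix of a parabolic
  \<open>P\<close>. If \<open>S\<close> were a union of blocks of \<open>E\<close>, the scheme would be a wreath product; hence \<open>B\<^sub>E A\<^sub>S\<close> is a
  multiple of \<open>J - A\<^sub>F\<close>, and \<open>G = A\<^sub>S - k/(mn) (J - A\<^sub>F)\<close> is annihilated by \<open>B\<^sub>E\<close>. With \<open>N = I - B\<^sub>E\<close>
  this forces \<open>G\<^sup>2 = b G + (f - 1) w\<^sup>2 N\<close>, where \<open>w = sqrt (k (mn - k) / (m (n - 1)))\<close> and \<open>b\<close> is an
  affine function of \<open>t\<close>. If \<open>\<theta>\<close>, \<open>\<tau>\<close> are the eigenvalues of \<open>G\<close> on the image of \<open>N\<close>, the primitive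
  idempotents are \<open>J/v\<close>, \<open>B\<^sub>F - J/v\<close>, \<open>B\<^sub>E - B\<^sub>F\<close> and the two spectral projections of \<open>G\<close>, whose ranks
  are in the ratio \<open>-\<tau> : \<theta>\<close>. The only two-dimensional entrywise subalgebra spanned by idempotents
  belongs to \<open>F\<close>, and apart from \<open>J/v\<close> and \<open>B\<^sub>F - J/v\<close> its relation \<open>\<sim>\<^sub>I\<close> links exactly the two
  projections of \<open>G\<close>. So the scheme is Q-Higmanian iff \<open>\<theta> = -(f - 1) \<tau>\<close> or \<open>\<tau> = -(f - 1) \<theta>\<close>; as
  \<open>(\<theta> + (f - 1) \<tau>) (\<tau> + (f - 1) \<theta>) = (f - 1) (b\<^sup>2 - (f - 2)\<^sup>2 w\<^sup>2)\<close>, this means \<open>b = \<plusminus>(f - 2) w\<close>.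
\<close>

section \<open>Complex matrices\<close>

lemma mat_scale_entry [simp]: "mat_scale c A $ i $ j = c * A $ i $ j"
  by (simp add: mat_scale_def)

lemma hadamard_entry [simp]: "hadamard A B $ i $ j = A $ i $ j * B $ i $ j"
  by (simp add: hadamard_def)

lemma all_ones_entry [simp]: "all_ones $ i $ j = 1"
  by (simp add: all_ones_def)

lemma adjacency_matrix_entry [simp]: "adjacency_matrix R $ i $ j = (if (i, j) \<in> R then 1 else 0)"
  by (simp add: adjacency_matrix_def)

lemma mat_scale_mult_left [simp]: "mat_scale c A ** B = mat_scale c (A ** B)"
  by (simp add: vec_eq_iff matrix_matrix_mult_def sum_distrib_left mult.assoc)

lemma mat_scale_mult_right [simp]: "A ** mat_scale c B = mat_scale c (A ** B)"
  by (simp add: vec_eq_iff matrix_matrix_mult_def sum_distrib_left mult.left_commute)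

lemma matrix_add_rdistrib: "(B + C) ** A = B ** A + C ** A"
  for A :: "'a::semiring_1^'n^'m"
  by (simp add: vec_eq_iff matrix_matrix_mult_def sum.distrib algebra_simps)

lemma matrix_diff_ldistrib: "A ** (B - C) = A ** B - A ** C"
  for A :: "'a::ring_1^'n^'m"
  by (simp add: vec_eq_iff matrix_matrix_mult_def sum_subtractf algebra_simps)

lemma matrix_diff_rdistrib: "(B - C) ** A = B ** A - C ** A"
  for A :: "'a::ring_1^'n^'m"
  by (simp add: vec_eq_iff matrix_matrix_mult_def sum_subtractf algebra_simps)

lemmas matrix_distribs =
  matrix_add_ldistrib matrix_add_rdistrib matrix_diff_ldistrib matrix_diff_rdistrib

lemma matrix_mult_sum_right: "A ** (\<Sum>i\<in>I. B i) = (\<Sum>i\<in>I. A ** B i)"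
  for A :: "'a::semiring_1^'n^'m"
  by (induction I rule: infinite_finite_induct) (auto simp: matrix_add_ldistrib)

lemma matrix_mult_sum_left: "(\<Sum>i\<in>I. B i) ** A = (\<Sum>i\<in>I. B i ** A)"
  for A :: "'a::semiring_1^'n^'m" and B :: "'i \<Rightarrow> 'a^'m^'k"
  by (induction I rule: infinite_finite_induct) (auto simp: matrix_add_rdistrib)

lemma hadamard_commute: "hadamard A B = hadamard B A"
  by (simp add: vec_eq_iff mult.commute)

lemma trace_mat_scale: "trace (mat_scale c A) = c * trace A"
  by (simp add: trace_def sum_distrib_left)

text \<open>Each member \<open>b\<close> of a basis of the row space of \<open>P\<close> satisfies \<open>b = b P\<close>; its own coordinate
  in this equation is its contribution to the trace.\<close>

lemma rank_idempotent_eq_trace: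
  fixes P :: "'a::field^'n^'n"
  assumes idempotent: "P ** P = P"
  shows "of_nat (rank P) = trace P"
proof -
  obtain B where B: "B \<subseteq> rows P" "vec.independent B" "rows P \<subseteq> vec.span B"
    "card B = vec.dim (rows P)"
    using vec.basis_exists[of "rows P"] by blast
  have "finite B"
    using B(2) vec.finiteI_independent by blast
  define coord where "coord = vec.representation B"
  have row_in_span: "row i P \<in> vec.span B" for i
    using B(3) by (auto simp: rows_def)
  have row_expansion: "row i P = (\<Sum>b\<in>B. coord (row i P) b *s b)" for i
    unfolding coord_def
    by (rule vec.sum_representation_eq[symmetric]) (use B \<open>finite B\<close> row_in_span in auto)
  have contribution: "(\<Sum>i\<in>UNIV. b $ i * coord (row i P) b) = 1" if "b \<in> B" for b
  proof -
    obtain r where "b = row r P"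
      using B(1) \<open>b \<in> B\<close> by (auto simp: rows_def)
    then have "b $ j = (\<Sum>i\<in>UNIV. b $ i *s row i P) $ j" for j
      using arg_cong[OF idempotent, of "\<lambda>Q. Q $ r $ j"]
      by (simp add: row_def matrix_matrix_mult_def)
    then have "b = (\<Sum>i\<in>UNIV. b $ i *s row i P)"
      by (intro vec_eq_iff[THEN iffD2] allI)
    then have "coord b b = coord (\<Sum>i\<in>UNIV. b $ i *s row i P) b"
      by (rule arg_cong[where f = "\<lambda>x. coord x b"])
    also have "\<dots> = (\<Sum>i\<in>UNIV. b $ i * coord (row i P) b)"
      using B(2) row_in_span
      by (simp add: coord_def vec.representation_sum vec.representation_scale vec.span_scale)
    finally show ?thesis
      using B(2) that by (simp add: coord_def vec.representation_basis)
  qed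
  have "P $ i $ i = (\<Sum>b\<in>B. b $ i * coord (row i P) b)" for i
    using arg_cong[OF row_expansion, of "\<lambda>x. x $ i" i] by (simp add: row_def mult.commute)
  then have "trace P = (\<Sum>b\<in>B. \<Sum>i\<in>UNIV. b $ i * coord (row i P) b)"
    unfolding trace_def by (simp add: sum.swap[of _ B])
  also have "\<dots> = of_nat (card B)"
    using contribution by simp
  finally show ?thesis
    using B(4) by (simp add: row_rank_def_gen)
qed

lemma trace_idempotent_neq_0:
  fixes P :: "'a::field_char_0^'n^'n"
  assumes "P ** P = P" "P \<noteq> 0"
  shows "trace P \<noteq> 0"
proof -
  obtain i where "row i P \<noteq> 0"
    using assms(2) by (auto simp: vec_eq_iff row_def)
  then have "rank P \<noteq> 0"
    by (auto simp: row_rank_def_gen rows_def)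
  then show ?thesis
    using rank_idempotent_eq_trace[OF assms(1)] by (metis of_nat_eq_0_iff)
qed

section \<open>Orthogonal idempotents\<close>

locale orthogonal_idempotents =
  fixes \<E> :: "(complex^'n::finite^'n) set"
  assumes finite_idempotents: "finite \<E>"
    and zero_notin: "0 \<notin> \<E>"
    and idempotent: "M \<in> \<E> \<Longrightarrow> M ** M = M"
    and orthogonal: "M \<in> \<E> \<Longrightarrow> M' \<in> \<E> \<Longrightarrow> M \<noteq> M' \<Longrightarrow> M ** M' = 0"
begin

lemma mult_idempotents: "M \<in> \<E> \<Longrightarrow> M' \<in> \<E> \<Longrightarrow> M ** M' = (if M = M' then M else 0)"
  using idempotent orthogonal by auto

lemma mult_combination:
  assumes "M \<in> \<E>" "B \<subseteq> \<E>"
  shows "M ** (\<Sum>M'\<in>B. mat_scale (c M') M') = (if M \<in> B then mat_scale (c M) M else 0)"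
proof -
  have "M ** (\<Sum>M'\<in>B. mat_scale (c M') M') = (\<Sum>M'\<in>B. if M = M' then mat_scale (c M') M' else 0)"
    unfolding matrix_mult_sum_right using assms
    by (intro sum.cong) (auto simp: mult_idempotents)
  then show ?thesis
    using finite_subset[OF assms(2) finite_idempotents] by simp
qed

lemma combination_mult:
  assumes "M \<in> \<E>" "B \<subseteq> \<E>"
  shows "(\<Sum>M'\<in>B. mat_scale (c M') M') ** M = (if M \<in> B then mat_scale (c M) M else 0)"
proof -
  have "(\<Sum>M'\<in>B. mat_scale (c M') M') ** M = (\<Sum>M'\<in>B. if M = M' then mat_scale (c M') M' else 0)"
    unfolding matrix_mult_sum_left using assms
    by (intro sum.cong) (auto simp: mult_idempotents)
  then show ?thesis
    using finite_subset[OF assms(2) finite_idempotents] by simp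
qed

lemma span_coordinates:
  assumes "A \<in> cmat.span B" "B \<subseteq> \<E>"
  obtains c where "A = (\<Sum>M\<in>B. mat_scale (c M) M)"
  using assms finite_subset[OF assms(2) finite_idempotents] by (auto simp: cmat.span_finite)

lemma span_eigenvalue:
  assumes "A \<in> cmat.span \<E>" "M \<in> \<E>"
  obtains c where "M ** A = mat_scale c M" "A ** M = mat_scale c M"
proof -
  obtain c where A: "A = (\<Sum>M\<in>\<E>. mat_scale (c M) M)"
    using span_coordinates[OF assms(1)] by blast
  show thesis
    using that[of "c M"] assms(2) by (simp add: A mult_combination combination_mult)
qed

lemma eq_0_if_mult_idempotents_eq_0:
  assumes A: "A \<in> cmat.span \<E>" and "\<And>M. M \<in> \<E> \<Longrightarrow> M ** A = 0"
  shows "A = 0"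
proof -
  obtain c where A: "A = (\<Sum>M\<in>\<E>. mat_scale (c M) M)"
    using span_coordinates[OF A] by blast
  have "mat_scale (c M) M = 0" if "M \<in> \<E>" for M
    using assms(2)[OF that] that by (simp add: A mult_combination)
  then show ?thesis
    unfolding A by (rule sum.neutral[OF ballI])
qed

lemma independent_idempotents: "cmat.independent \<E>"
proof (rule cmat.independent_if_scalars_zero[OF finite_idempotents])
  fix c M assume "(\<Sum>M\<in>\<E>. mat_scale (c M) M) = 0" "M \<in> \<E>"
  then have "mat_scale (c M) M = 0"
    using mult_combination[OF \<open>M \<in> \<E>\<close> subset_refl, of c] by simp
  then show "c M = 0"
    using \<open>M \<in> \<E>\<close> zero_notin by auto
qed

lemma in_span_iff:
  assumes "B \<subseteq> \<E>" "M \<in> \<E>"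
  shows "M \<in> cmat.span B \<longleftrightarrow> M \<in> B"
proof
  assume "M \<in> cmat.span B"
  then have "M \<in> cmat.span (\<E> - {M})" if "M \<notin> B"
    using cmat.span_mono[of B "\<E> - {M}"] assms(1) that by blast
  then show "M \<in> B"
    using independent_idempotents assms(2) by (auto simp: cmat.dependent_def)
qed (rule cmat.span_base)

lemma span_eq_fixed:
  assumes "B \<subseteq> \<E>"
  shows "cmat.span B = {A \<in> cmat.span \<E>. \<Sum>B ** A = A}"
proof (intro equalityI subsetI CollectI conjI)
  have Sum_mult: "\<Sum>B ** M = (if M \<in> B then M else 0)" if "M \<in> \<E>" for M
    using combination_mult[OF that assms, of "\<lambda>_. 1"] by simp
  fix A assume A: "A \<in> cmat.span B"
  then show "A \<in> cmat.span \<E>"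
    using cmat.span_mono[OF assms] by blast
  obtain c where A: "A = (\<Sum>M\<in>B. mat_scale (c M) M)"
    using span_coordinates[OF A assms] .
  show "\<Sum>B ** A = A"
    unfolding A matrix_mult_sum_right using assms by (intro sum.cong) (auto simp: Sum_mult)
next
  fix A assume A: "A \<in> {A \<in> cmat.span \<E>. \<Sum>B ** A = A}"
  have "M ** A \<in> cmat.span B" if "M \<in> B" for M
  proof -
    have "A \<in> cmat.span \<E>" "M \<in> \<E>"
      using A that assms by auto
    then obtain c where "M ** A = mat_scale c M"
      by (rule span_eigenvalue)
    with that show ?thesis
      by (simp add: cmat.span_base cmat.span_scale)
  qed
  then have "\<Sum>B ** A \<in> cmat.span B"
    unfolding matrix_mult_sum_left by (rule cmat.span_sum)
  then show "A \<in> cmat.span B"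
    using A by simp
qed

lemma idempotent_eigenvalue:
  assumes "A \<in> cmat.span \<E>" "A ** A = A" "M \<in> \<E>"
  shows "M ** A = 0 \<or> M ** A = M \<and> A ** M = M"
proof -
  obtain c where c: "M ** A = mat_scale c M" "A ** M = mat_scale c M"
    using span_eigenvalue[OF assms(1,3)] .
  have "M ** A = (M ** A) ** A"
    by (simp only: matrix_mul_assoc[symmetric] assms(2))
  then have "mat_scale (c * c) M = mat_scale c M"
    by (simp add: c(1))
  moreover have "M \<noteq> 0"
    using assms(3) zero_notin by blast
  ultimately have "c * c = c"
    by simp
  then show ?thesis
    using c by auto
qed

lemma primitive_idempotents_eq:
  assumes X: "adjacency_algebra X = cmat.span \<E>"
  shows "primitive_idempotents X = \<E>"
proof (intro equalityI subsetI)
  fix A assume A: "A \<in> primitive_idempotents X"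
  then obtain M where M: "M \<in> \<E>" "M ** A \<noteq> 0"
    using eq_0_if_mult_idempotents_eq_0 unfolding primitive_idempotents_def X by blast
  then have "M ** A = M" "A ** M = M"
    using A idempotent_eigenvalue unfolding primitive_idempotents_def X by blast+
  then have "M = 0 \<or> M = A"
    using A idempotent[OF M(1)] cmat.span_base[OF M(1)]
    unfolding primitive_idempotents_def X by blast
  then show "A \<in> \<E>"
    using M(1) zero_notin by auto
next
  fix M assume M: "M \<in> \<E>"
  then have "Q = 0 \<or> Q = M" if "Q \<in> cmat.span \<E>" "Q ** Q = Q" "M ** Q = Q" for Q
    using idempotent_eigenvalue[of Q M] that by auto
  moreover have "M \<noteq> 0"
    using M zero_notin by blast
  ultimately show "M \<in> primitive_idempotents X"
    using M idempotent cmat.span_base unfolding primitive_idempotents_def X by blast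
qed

text \<open>Independent matrices in an algebra of dimension at most \<open>card \<E>\<close> span it.\<close>

lemma adjacency_algebra_eq_span:
  assumes "\<E> \<subseteq> adjacency_algebra X" "finite X" "card X \<le> card \<E>"
  shows "adjacency_algebra X = cmat.span \<E>"
proof
  show "cmat.span \<E> \<subseteq> adjacency_algebra X"
    using assms(1) unfolding adjacency_algebra_def by (intro cmat.span_minimal cmat.subspace_span)
  show "adjacency_algebra X \<subseteq> cmat.span \<E>"
  proof (rule subsetI, rule ccontr)
    fix A assume A: "A \<in> adjacency_algebra X" "A \<notin> cmat.span \<E>"
    then have "cmat.independent (insert A \<E>)"
      using independent_idempotents by (intro cmat.independent_insertI)
    moreover have "insert A \<E> \<subseteq> cmat.span (adjacency_matrix ` X)"
      using A assms(1) by (simp add: adjacency_algebra_def)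
    ultimately have "card (insert A \<E>) \<le> card (adjacency_matrix ` X :: (complex^'n^'n) set)"
      using cmat.independent_span_bound[of "adjacency_matrix ` X" "insert A \<E>"] assms(2) by blast
    also have "\<dots> \<le> card \<E>"
      using card_image_le[OF assms(2)] assms(3) by (rule order_trans)
    finally show False
      using A(2) cmat.span_base[of A \<E>] finite_idempotents
      by (auto simp: card_insert_if split: if_splits)
  qed
qed

end

lemma orthogonal_idempotents_list:
  assumes orthogonal: "sorted_wrt (\<lambda>M M'. M ** M' = 0 \<and> M' ** M = 0) Ms"
    and idempotent: "\<And>M. M \<in> set Ms \<Longrightarrow> M ** M = M" and nonzero: "0 \<notin> set Ms"
  shows "orthogonal_idempotents (set Ms)" and "distinct Ms"
proof -
  have zero: "Ms ! i ** Ms ! j = 0" if "i < length Ms" "j < length Ms" "i \<noteq> j" for i j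
    using orthogonal that unfolding sorted_wrt_iff_nth_less by (cases i j rule: linorder_cases) auto
  show "orthogonal_idempotents (set Ms)"
    using nonzero by unfold_locales (auto simp: idempotent in_set_conv_nth intro: zero)
  show "distinct Ms"
    unfolding distinct_conv_nth
    using zero idempotent nonzero by (metis nth_mem)
qed

locale enumerated_idempotents = orthogonal_idempotents \<E>
  for \<E> :: "(complex^'n::finite^'n) set" +
  fixes d :: nat and Es :: "nat \<Rightarrow> complex^'n^'n"
  assumes enumeration: "bij_betw Es {..d} \<E>"
begin

lemma in_idempotents: "i \<le> d \<Longrightarrow> Es i \<in> \<E>"
  using bij_betwE[OF enumeration] by simp

lemma eq_iff: "i \<le> d \<Longrightarrow> j \<le> d \<Longrightarrow> Es i = Es j \<longleftrightarrow> i = j"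
  using bij_betw_imp_inj_on[OF enumeration] by (auto simp: inj_on_def)

lemma Es_mult_combination:
  assumes "k \<le> d" "I \<subseteq> {..d}"
  shows "Es k ** (\<Sum>i\<in>I. mat_scale (c i) (Es i)) = (if k \<in> I then mat_scale (c k) (Es k) else 0)"
proof -
  have "Es k ** (\<Sum>i\<in>I. mat_scale (c i) (Es i)) =
      (\<Sum>i\<in>I. if k = i then mat_scale (c i) (Es i) else 0)"
    unfolding matrix_mult_sum_right using assms in_idempotents eq_iff
    by (intro sum.cong) (auto simp: mult_idempotents subset_iff)
  then show ?thesis
    using finite_subset[OF assms(2)] by simp
qed

lemma krein_eqI:
  assumes "hadamard (Es i) (Es j) = (\<Sum>k\<le>d. mat_scale (c k) (Es k))"
  shows "krein d Es i j = (\<lambda>k. if k \<le> d then of_nat CARD('n) * c k else 0)"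
proof -
  have scaled_sum: "mat_scale (1 / of_nat CARD('n)) (\<Sum>k\<le>d. mat_scale (q k) (Es k)) =
      (\<Sum>k\<le>d. mat_scale (q k / of_nat CARD('n)) (Es k))" for q
    by (simp add: cmat.scale_sum_right)
  show ?thesis
    unfolding krein_def
  proof (rule the_equality)
    fix q
    assume q: "(\<forall>k>d. q k = 0) \<and> hadamard (Es i) (Es j) =
      mat_scale (1 / of_nat CARD('n)) (\<Sum>k\<le>d. mat_scale (q k) (Es k))"
    have "q k = of_nat CARD('n) * c k" if "k \<le> d" for k
    proof -
      have "Es k ** (\<Sum>i\<le>d. mat_scale (c i) (Es i)) =
          Es k ** (\<Sum>i\<le>d. mat_scale (q i / of_nat CARD('n)) (Es i))"
        using q unfolding assms scaled_sum by simp
      then have "mat_scale (c k) (Es k) = mat_scale (q k / of_nat CARD('n)) (Es k)"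
        using that by (simp only: Es_mult_combination[OF that subset_refl] atMost_iff if_True)
      moreover have "Es k \<noteq> 0"
        using in_idempotents[OF that] zero_notin by metis
      ultimately show ?thesis
        by simp
    qed
    then show "q = (\<lambda>k. if k \<le> d then of_nat CARD('n) * c k else 0)"
      using q by auto
  qed (auto simp: assms scaled_sum intro!: sum.cong)
qed

lemma krein_neq_0_iff:
  assumes "hadamard (Es i) (Es j) \<in> cmat.span \<E>" "k \<le> d"
  shows "krein d Es i j k \<noteq> 0 \<longleftrightarrow> Es k ** hadamard (Es i) (Es j) \<noteq> 0"
proof -
  obtain c where "hadamard (Es i) (Es j) = (\<Sum>M\<in>\<E>. mat_scale (c M) M)"
    using span_coordinates[OF assms(1)] by blast
  then have H: "hadamard (Es i) (Es j) = (\<Sum>k\<le>d. mat_scale (c (Es k)) (Es k))"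
    using sum.reindex_bij_betw[OF enumeration, of "\<lambda>M. mat_scale (c M) M"] by simp
  moreover have "Es k \<noteq> 0"
    using in_idempotents[OF assms(2)] zero_notin by metis
  ultimately show ?thesis
    using assms(2) Es_mult_combination[OF assms(2) subset_refl, of "\<lambda>k. c (Es k)"]
    by (simp add: krein_eqI[OF H])
qed

lemma index_relation_iff:
  assumes I: "I \<subseteq> {..d}"
    and closed: "\<And>M M'. M \<in> \<E> \<Longrightarrow> M' \<in> \<E> \<Longrightarrow> hadamard M M' \<in> cmat.span \<E>"
  shows "(i, j) \<in> index_relation d Es I \<longleftrightarrow>
    i \<le> d \<and> j \<le> d \<and> (\<Sum>k\<in>I. Es k) ** hadamard (Es i) (Es j) \<noteq> 0"
proof (cases "i \<le> d \<and> j \<le> d")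
  case True
  let ?H = "hadamard (Es i) (Es j)"
  have H: "?H \<in> cmat.span \<E>"
    using True in_idempotents closed by blast
  have "Es k ** ?H = (Es k ** (\<Sum>k\<in>I. Es k)) ** ?H" if "k \<in> I" for k
    using Es_mult_combination[of k I "\<lambda>_. 1"] I that by auto
  then have "Es k ** ?H = Es k ** ((\<Sum>k\<in>I. Es k) ** ?H)" if "k \<in> I" for k
    using that by (simp only: matrix_mul_assoc)
  then have "(\<Sum>k\<in>I. Es k) ** ?H = 0 \<longleftrightarrow> (\<forall>k\<in>I. Es k ** ?H = 0)"
    by (auto simp: matrix_mult_sum_left)
  then show ?thesis
    using True I krein_neq_0_iff[OF H] by (auto simp: index_relation_def)
qed (auto simp: index_relation_def)

end

text \<open>If \<open>G\<close> has eigenvalues \<open>\<theta>\<close> and \<open>\<tau>\<close> on the image of the idempotent \<open>N\<close>, this is the projection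
  onto the eigenspace of \<open>\<theta>\<close>.\<close>

definition spectral_projection ::
    "complex^'n^'n \<Rightarrow> complex^'n^'n \<Rightarrow> complex \<Rightarrow> complex \<Rightarrow> complex^'n^'n" where
  "spectral_projection N G \<theta> \<tau> = mat_scale (1 / (\<theta> - \<tau>)) (G - mat_scale \<tau> N)"

lemma spectral_projections:
  fixes N G :: "complex^'n::finite^'n"
  assumes N: "N ** N = N" "N ** G = G" "G ** N = G"
    and G: "G ** G = mat_scale (\<theta> + \<tau>) G - mat_scale (\<theta> * \<tau>) N" and "\<theta> \<noteq> \<tau>"
  shows "spectral_projection N G \<theta> \<tau> ** spectral_projection N G \<theta> \<tau> = spectral_projection N G \<theta> \<tau>"
    and "spectral_projection N G \<theta> \<tau> ** spectral_projection N G \<tau> \<theta> = 0"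
    and "spectral_projection N G \<theta> \<tau> + spectral_projection N G \<tau> \<theta> = N"
proof -
  have "(G - mat_scale \<tau> N) ** (G - mat_scale \<tau> N) = mat_scale (\<theta> - \<tau>) (G - mat_scale \<tau> N)"
    "(G - mat_scale \<tau> N) ** (G - mat_scale \<theta> N) = 0"
    by (simp_all add: matrix_distribs N G vec_eq_iff algebra_simps)
  then show "spectral_projection N G \<theta> \<tau> ** spectral_projection N G \<theta> \<tau> =
      spectral_projection N G \<theta> \<tau>"
    "spectral_projection N G \<theta> \<tau> ** spectral_projection N G \<tau> \<theta> = 0"
    using \<open>\<theta> \<noteq> \<tau>\<close> by (simp_all add: spectral_projection_def)
  define c where "c = 1 / (\<theta> - \<tau>)"
  have c: "1 / (\<tau> - \<theta>) = - c" "c * \<theta> = 1 + c * \<tau>"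
    using \<open>\<theta> \<noteq> \<tau>\<close> by (simp_all add: c_def divide_simps)
  show "spectral_projection N G \<theta> \<tau> + spectral_projection N G \<tau> \<theta> = N"
    unfolding spectral_projection_def c(1) c_def[symmetric]
    by (simp add: vec_eq_iff right_diff_distrib mult.assoc[symmetric] c(2) distrib_right)
qed

section \<open>The adjacency algebra of a scheme\<close>

lemma adjacency_algebra_constant:
  assumes "A \<in> adjacency_algebra X" "disjoint X" "R \<in> X" "(\<alpha>, \<beta>) \<in> R" "(\<gamma>, \<delta>) \<in> R"
  shows "A $ \<alpha> $ \<beta> = A $ \<gamma> $ \<delta>"
  using assms(1) unfolding adjacency_algebra_def
proof (induction rule: cmat.span_induct_alt)
  case (step c B A)
  then obtain Q where Q: "Q \<in> X" "B = adjacency_matrix Q"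
    by auto
  have "(\<alpha>, \<beta>) \<in> Q \<longleftrightarrow> (\<gamma>, \<delta>) \<in> Q"
    using assms(2-5) Q(1) by (auto simp: disjoint_def)
  then show ?case
    using Q(2) step.IH by simp
qed simp

lemma in_adjacency_algebraI:
  fixes A :: "complex^'n::finite^'n"
  assumes X: "partition_on UNIV X"
    and const: "\<And>R \<alpha> \<beta> \<gamma> \<delta>. R \<in> X \<Longrightarrow> (\<alpha>, \<beta>) \<in> R \<Longrightarrow> (\<gamma>, \<delta>) \<in> R \<Longrightarrow> A $ \<alpha> $ \<beta> = A $ \<gamma> $ \<delta>"
  shows "A \<in> adjacency_algebra X"
proof -
  have "\<exists>a. \<forall>\<alpha> \<beta>. (\<alpha>, \<beta>) \<in> R \<longrightarrow> A $ \<alpha> $ \<beta> = a" if "R \<in> X" for R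
  proof -
    obtain \<gamma> \<delta> where "(\<gamma>, \<delta>) \<in> R"
      using partition_onD3[OF X] \<open>R \<in> X\<close> by (cases "R = {}") auto
    then show ?thesis
      using const \<open>R \<in> X\<close> by blast
  qed
  then obtain a where a: "\<And>R \<alpha> \<beta>. R \<in> X \<Longrightarrow> (\<alpha>, \<beta>) \<in> R \<Longrightarrow> A $ \<alpha> $ \<beta> = a R"
    by metis
  have "A $ \<alpha> $ \<beta> = (\<Sum>Q\<in>X. mat_scale (a Q) (adjacency_matrix Q)) $ \<alpha> $ \<beta>" for \<alpha> \<beta>
  proof -
    obtain R where R: "R \<in> X" "(\<alpha>, \<beta>) \<in> R"
      using partition_onD1[OF X] by blast
    have "(\<Sum>Q\<in>X. mat_scale (a Q) (adjacency_matrix Q)) $ \<alpha> $ \<beta> = (\<Sum>Q\<in>X. if Q = R then a Q else 0)"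
      unfolding sum_component using R partition_onD2[OF X]
      by (intro sum.cong) (auto simp: disjoint_def)
    then show ?thesis
      using R a by simp
  qed
  then have "A = (\<Sum>Q\<in>X. mat_scale (a Q) (adjacency_matrix Q))"
    by (simp add: vec_eq_iff)
  moreover have "(\<Sum>Q\<in>X. mat_scale (a Q) (adjacency_matrix Q)) \<in> adjacency_algebra X"
    unfolding adjacency_algebra_def by (intro cmat.span_sum cmat.span_scale cmat.span_base imageI)
  ultimately show ?thesis
    by simp
qed

lemma adjacency_mult_entry:
  "(adjacency_matrix R ** A) $ \<alpha> $ \<beta> = (\<Sum>\<gamma>\<in>R `` {\<alpha> :: 'n::finite}. A $ \<gamma> $ \<beta>)"
proof -
  have "(adjacency_matrix R ** A) $ \<alpha> $ \<beta> = (\<Sum>\<gamma>\<in>UNIV. if \<gamma> \<in> R `` {\<alpha>} then A $ \<gamma> $ \<beta> else 0)"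
    unfolding matrix_matrix_mult_def by (auto intro!: sum.cong)
  then show ?thesis
    by (simp add: sum.If_cases Image_singleton)
qed

lemma adjacency_mult_adjacency_entry:
  "(adjacency_matrix R ** adjacency_matrix S) $ \<alpha> $ \<beta> =
    of_nat (card {\<gamma> :: 'n::finite. (\<alpha>, \<gamma>) \<in> R \<and> (\<gamma>, \<beta>) \<in> S})"
  by (simp add: adjacency_mult_entry sum.If_cases Image_singleton Collect_conj_eq)

lemma valency_eqI:
  assumes "\<And>\<alpha>. \<alpha> \<in> \<Omega> \<Longrightarrow> card (R `` {\<alpha>}) = n" "\<Omega> \<noteq> {}"
  shows "valency \<Omega> R = n"
  unfolding valency_def using assms by (intro the_equality) auto

lemma constant_on_blocks_iff:
  assumes P: "equiv UNIV P"
  shows "constant_on_blocks P A \<longleftrightarrow>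
    (\<forall>\<alpha> \<alpha>' \<beta> \<beta>'. (\<alpha>, \<alpha>') \<in> P \<longrightarrow> (\<beta>, \<beta>') \<in> P \<longrightarrow> A $ \<alpha> $ \<beta> = A $ \<alpha>' $ \<beta>')"
proof (intro iffI allI impI)
  fix \<alpha> \<alpha>' \<beta> \<beta>' assume blocks: "constant_on_blocks P A" and "(\<alpha>, \<alpha>') \<in> P" "(\<beta>, \<beta>') \<in> P"
  then have "\<alpha> \<in> P `` {\<alpha>}" "\<alpha>' \<in> P `` {\<alpha>}" "\<beta> \<in> P `` {\<beta>}" "\<beta>' \<in> P `` {\<beta>}"
    using equiv_class_self[OF P] by auto
  then show "A $ \<alpha> $ \<beta> = A $ \<alpha>' $ \<beta>'"
    by (intro blocks[unfolded constant_on_blocks_def, rule_format,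
          of "P `` {\<alpha>}" "P `` {\<beta>}"] quotientI) simp_all
next
  assume const: "\<forall>\<alpha> \<alpha>' \<beta> \<beta>'. (\<alpha>, \<alpha>') \<in> P \<longrightarrow> (\<beta>, \<beta>') \<in> P \<longrightarrow> A $ \<alpha> $ \<beta> = A $ \<alpha>' $ \<beta>'"
  show "constant_on_blocks P A"
    unfolding constant_on_blocks_def
  proof (intro ballI)
    fix \<Delta> \<Gamma> \<alpha> \<alpha>' \<beta> \<beta>'
    assume "\<Delta> \<in> UNIV // P" "\<Gamma> \<in> UNIV // P" "\<alpha> \<in> \<Delta>" "\<alpha>' \<in> \<Delta>" "\<beta> \<in> \<Gamma>" "\<beta>' \<in> \<Gamma>"
    then have "(\<alpha>, \<alpha>') \<in> P" "(\<beta>, \<beta>') \<in> P"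
      using P by (meson quotient_eq_iff)+
    then show "A $ \<alpha> $ \<beta> = A $ \<alpha>' $ \<beta>'"
      using const by blast
  qed
qed

lemma constant_on_blocks_adjacency_matrix_self:
  assumes P: "equiv UNIV P"
  shows "constant_on_blocks P (adjacency_matrix P)"
  unfolding constant_on_blocks_iff[OF P] by (simp add: equiv_class_eq_iff[OF P])

lemma subset_if_constant_on_blocks_adjacency_matrix:
  assumes "equiv UNIV P" "equiv UNIV Q" "constant_on_blocks P (adjacency_matrix Q)"
  shows "P \<subseteq> Q"
proof (rule subrelI)
  fix \<alpha> \<beta> assume "(\<alpha>, \<beta>) \<in> P"
  moreover have "(\<alpha>, \<alpha>) \<in> P" "(\<alpha>, \<alpha>) \<in> Q"
    using assms(1,2) by (auto simp: equiv_def refl_on_def)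
  ultimately have "adjacency_matrix Q $ \<alpha> $ \<alpha> = adjacency_matrix Q $ \<alpha> $ \<beta>"
    using assms(3) unfolding constant_on_blocks_iff[OF assms(1)] by blast
  then show "(\<alpha>, \<beta>) \<in> Q"
    using \<open>(\<alpha>, \<alpha>) \<in> Q\<close> by (simp split: if_splits)
qed

definition block_algebra :: "('n::finite \<times> 'n) set set \<Rightarrow> ('n \<times> 'n) set \<Rightarrow> (complex^'n^'n) set" where
  "block_algebra X P = {A \<in> adjacency_algebra X. constant_on_blocks P A}"

definition averaging_matrix :: "('n::finite \<times> 'n) set \<Rightarrow> complex^'n^'n" where
  "averaging_matrix P = mat_scale (1 / of_nat (valency UNIV P)) (adjacency_matrix P)"

lemma averaging_mult_entry:
  "(averaging_matrix P ** A) $ \<alpha> $ \<beta> = (\<Sum>\<gamma>\<in>P `` {\<alpha>}. A $ \<gamma> $ \<beta>) / of_nat (valency UNIV P)"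
  for A :: "complex^'n::finite^'n"
  by (simp add: averaging_matrix_def adjacency_mult_entry)

lemma valency_Id: "valency UNIV (Id :: ('n::finite \<times> 'n) set) = 1"
  by (rule valency_eqI) auto

lemma valency_UNIV: "valency UNIV (UNIV :: ('n::finite \<times> 'n) set) = CARD('n)"
  by (rule valency_eqI) (auto simp: Image_def)

lemma averaging_matrix_Id: "averaging_matrix Id = mat 1"
  by (simp add: averaging_matrix_def valency_Id vec_eq_iff mat_def)

lemma averaging_matrix_UNIV:
  "averaging_matrix (UNIV :: ('n::finite \<times> 'n) set) = mat_scale (1 / of_nat CARD('n)) all_ones"
  by (simp add: averaging_matrix_def valency_UNIV vec_eq_iff)

lemma hadamard_subalgebra_span_pair_two_values:
  assumes "hadamard_subalgebra X (cmat.span {mat_scale c all_ones, M})"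
  shows "M $ \<alpha> $ \<beta> = M $ \<alpha>' $ \<beta>' \<or> M $ \<alpha> $ \<beta> = M $ \<gamma> $ \<delta> \<or> M $ \<alpha>' $ \<beta>' = M $ \<gamma> $ \<delta>"
proof -
  have "hadamard M M \<in> cmat.span {mat_scale c all_ones, M}"
    using assms unfolding hadamard_subalgebra_def by (blast intro: cmat.span_base)
  then obtain p where "hadamard M M - mat_scale p (mat_scale c all_ones) \<in> cmat.span {M}"
    unfolding cmat.span_insert by blast
  then obtain q where q: "hadamard M M - mat_scale p (mat_scale c all_ones) = mat_scale q M"
    by (auto simp: cmat.span_singleton)
  have quadratic: "M $ i $ j * M $ i $ j - p * c = q * M $ i $ j" for i j
    using arg_cong[OF q, of "\<lambda>A. A $ i $ j"] by simp
  have "(x - y) * (x - z) * (y - z) = 0"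
    if "x * x - p * c = q * x" "y * y - p * c = q * y" "z * z - p * c = q * z" for x y z :: complex
    using that by algebra
  from this[OF quadratic quadratic quadratic] show ?thesis
    by auto
qed

text \<open>For \<open>P = E(I)\<close> this is the relation \<open>\<sim>\<^sub>I\<close> on the primitive idempotents.\<close>

definition linked :: "('n::finite \<times> 'n) set \<Rightarrow> complex^'n^'n \<Rightarrow> complex^'n^'n \<Rightarrow> bool" where
  "linked P M M' \<longleftrightarrow> averaging_matrix P ** hadamard M M' \<noteq> 0"

lemma linked_commute: "linked P M M' \<longleftrightarrow> linked P M' M"
  by (simp add: linked_def hadamard_commute)

locale scheme =
  fixes X :: "('n::finite \<times> 'n) set set"
  assumes association: "association_scheme UNIV X"
begin

lemma partition: "partition_on UNIV X"
  using association by (simp add: association_scheme_def)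

lemma Union_relations: "\<Union>X = UNIV"
  using partition_onD1[OF partition] by simp

lemma relation_eqI: "R \<in> X \<Longrightarrow> Q \<in> X \<Longrightarrow> p \<in> R \<Longrightarrow> p \<in> Q \<Longrightarrow> R = Q"
  using partition_onD2[OF partition] by (auto simp: disjoint_def)

lemma relation_nonempty: "R \<in> X \<Longrightarrow> R \<noteq> {}"
  using partition_onD3[OF partition] by auto

lemma Id_in_relations: "Id \<in> X"
proof -
  have "Id_on (UNIV :: 'n set) = Id"
    by auto
  then show ?thesis
    using association by (simp add: association_scheme_def)
qed

lemma converse_in_relations: "R \<in> X \<Longrightarrow> R\<inverse> \<in> X"
  using association by (simp add: association_scheme_def)

lemmas algebra_constant = adjacency_algebra_constant[OF _ partition_onD2[OF partition]]
lemmas in_algebraI = in_adjacency_algebraI[OF partition]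

lemma subspace_algebra: "cmat.subspace (adjacency_algebra X)"
  unfolding adjacency_algebra_def by (rule cmat.subspace_span)

lemmas algebra_add = cmat.subspace_add[OF subspace_algebra]
lemmas algebra_diff = cmat.subspace_diff[OF subspace_algebra]
lemmas algebra_scale = cmat.subspace_scale[OF subspace_algebra]

lemma all_ones_in_algebra: "all_ones \<in> adjacency_algebra X"
  by (rule in_algebraI) simp

lemma adjacency_in_algebra: "R \<in> X \<Longrightarrow> adjacency_matrix R \<in> adjacency_algebra X"
  unfolding adjacency_algebra_def by (rule cmat.span_base) auto

lemma adjacency_Union_in_algebra:
  assumes "Y \<subseteq> X"
  shows "adjacency_matrix (\<Union>Y) \<in> adjacency_algebra X"
proof (rule in_algebraI)
  fix R \<alpha> \<beta> \<gamma> \<delta> assume "R \<in> X" "(\<alpha>, \<beta>) \<in> R" "(\<gamma>, \<delta>) \<in> R"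
  then have "(\<alpha>, \<beta>) \<in> \<Union>Y \<longleftrightarrow> (\<gamma>, \<delta>) \<in> \<Union>Y"
    using relation_eqI assms by blast
  then show "adjacency_matrix (\<Union>Y) $ \<alpha> $ \<beta> = (adjacency_matrix (\<Union>Y) $ \<gamma> $ \<delta> :: complex)"
    by simp
qed

lemma hadamard_in_algebra:
  assumes "A \<in> adjacency_algebra X" "B \<in> adjacency_algebra X"
  shows "hadamard A B \<in> adjacency_algebra X"
proof (rule in_algebraI)
  fix R \<alpha> \<beta> \<gamma> \<delta> assume "R \<in> X" "(\<alpha>, \<beta>) \<in> R" "(\<gamma>, \<delta>) \<in> R"
  note R = this
  show "hadamard A B $ \<alpha> $ \<beta> = hadamard A B $ \<gamma> $ \<delta>"
    by (simp only: hadamard_entry algebra_constant[OF assms(1) R] algebra_constant[OF assms(2) R])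
qed

lemma adjacency_mult_adjacency_in_algebra:
  assumes "R \<in> X" "S \<in> X"
  shows "adjacency_matrix R ** adjacency_matrix S \<in> adjacency_algebra X"
proof (rule in_algebraI)
  fix T \<alpha> \<beta> \<gamma> \<delta> assume T: "T \<in> X" "(\<alpha>, \<beta>) \<in> T" "(\<gamma>, \<delta>) \<in> T"
  obtain p where "\<forall>(\<alpha>, \<beta>)\<in>T. card {\<gamma>. (\<alpha>, \<gamma>) \<in> R \<and> (\<gamma>, \<beta>) \<in> S} = p"
    using association assms T(1) unfolding association_scheme_def by meson
  with T have "card {\<epsilon>. (\<alpha>, \<epsilon>) \<in> R \<and> (\<epsilon>, \<beta>) \<in> S} = p" "card {\<epsilon>. (\<gamma>, \<epsilon>) \<in> R \<and> (\<epsilon>, \<delta>) \<in> S} = p"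
    by blast+
  then show "(adjacency_matrix R ** adjacency_matrix S) $ \<alpha> $ \<beta> =
      ((adjacency_matrix R ** adjacency_matrix S) $ \<gamma> $ \<delta> :: complex)"
    by (simp only: adjacency_mult_adjacency_entry)
qed

lemma mult_in_algebra:
  assumes "A \<in> adjacency_algebra X" "B \<in> adjacency_algebra X"
  shows "A ** B \<in> adjacency_algebra X"
proof -
  note zero_in_algebra = cmat.subspace_0[OF subspace_algebra]
  have left_basic: "adjacency_matrix R ** B \<in> adjacency_algebra X" if "R \<in> X" for R
  proof -
    from assms(2) have "B \<in> cmat.span (adjacency_matrix ` X)"
      by (simp add: adjacency_algebra_def)
    then show ?thesis
    proof (induction rule: cmat.span_induct_alt)
      case (step c A B)
      then show ?case
        using adjacency_mult_adjacency_in_algebra[OF that]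
        by (auto simp: matrix_add_ldistrib intro!: algebra_add algebra_scale)
    qed (simp add: zero_in_algebra)
  qed
  from assms(1) have "A \<in> cmat.span (adjacency_matrix ` X)"
    by (simp add: adjacency_algebra_def)
  then show ?thesis
  proof (induction rule: cmat.span_induct_alt)
    case (step c A A')
    then show ?case
      using left_basic by (auto simp: matrix_add_rdistrib intro!: algebra_add algebra_scale)
  qed (simp add: zero_in_algebra)
qed

lemma card_paths_constant:
  assumes "adjacency_matrix R \<in> adjacency_algebra X" "adjacency_matrix S \<in> adjacency_algebra X"
    and "T \<in> X" "(\<alpha>, \<beta>) \<in> T" "(\<alpha>', \<beta>') \<in> T"
  shows "card {\<gamma>. (\<alpha>, \<gamma>) \<in> R \<and> (\<gamma>, \<beta>) \<in> S} = card {\<gamma>. (\<alpha>', \<gamma>) \<in> R \<and> (\<gamma>, \<beta>') \<in> S}"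
  using algebra_constant[OF mult_in_algebra[OF assms(1,2)] assms(3-5)]
  by (simp add: adjacency_mult_adjacency_entry)

lemma intersection_number_eq:
  assumes "R \<in> X" "S \<in> X" "T \<in> X" "(\<alpha>, \<beta>) \<in> T"
  shows "intersection_number R S T = card {\<gamma>. (\<alpha>, \<gamma>) \<in> R \<and> (\<gamma>, \<beta>) \<in> S}"
  unfolding intersection_number_def
proof (rule the_equality)
  show "\<forall>(\<alpha>', \<beta>')\<in>T. card {\<gamma>. (\<alpha>', \<gamma>) \<in> R \<and> (\<gamma>, \<beta>') \<in> S} = card {\<gamma>. (\<alpha>, \<gamma>) \<in> R \<and> (\<gamma>, \<beta>) \<in> S}"
    using card_paths_constant assms adjacency_in_algebra by blast
qed (use assms(4) in auto)

lemma card_Image_eq_valency: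
  assumes "adjacency_matrix R \<in> adjacency_algebra X"
  shows "card (R `` {\<alpha>}) = valency UNIV R"
proof -
  have "(adjacency_matrix R ** all_ones) $ \<beta> $ \<beta> = of_nat (card (R `` {\<beta>}))" for \<beta>
    by (simp add: adjacency_mult_entry Image_def)
  then have "card (R `` {\<beta>}) = card (R `` {\<alpha>})" for \<beta>
    using algebra_constant[OF mult_in_algebra[OF assms all_ones_in_algebra]
        Id_in_relations, of \<beta> \<beta> \<alpha> \<alpha>]
    by simp
  then show ?thesis
    using valency_eqI[of UNIV R "card (R `` {\<alpha>})"] by simp
qed

lemma valency_relation_pos:
  assumes "R \<in> X"
  shows "0 < valency UNIV R"
proof -
  obtain \<alpha> \<beta> where "(\<alpha>, \<beta>) \<in> R"
    using relation_nonempty[OF assms] by auto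
  then have "R `` {\<alpha>} \<noteq> {}"
    by auto
  then show ?thesis
    using card_Image_eq_valency[OF adjacency_in_algebra[OF assms], of \<alpha>]
    by (metis card_gt_0_iff finite)
qed

lemma parabolic_Id: "parabolic UNIV X Id"
  unfolding parabolic_def using Id_in_relations
  by (intro conjI exI[of _ "{Id}"]) (auto simp: equiv_def refl_on_def sym_def trans_def)

lemma parabolic_UNIV: "parabolic UNIV X UNIV"
  unfolding parabolic_def using Union_relations
  by (intro conjI exI[of _ X]) (auto simp: equiv_def refl_on_def sym_def trans_def)

lemma parabolic_Union_eq:
  assumes "parabolic UNIV X P"
  shows "\<Union>{R \<in> X. R \<subseteq> P} = P"
  using assms unfolding parabolic_def by auto

lemma parabolic_relation_cases:
  assumes "parabolic UNIV X P" "R \<in> X"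
  shows "R \<subseteq> P \<or> R \<inter> P = {}"
  using parabolic_Union_eq[OF assms(1)] relation_eqI[OF _ assms(2)] by blast

lemma parabolic_in_algebra:
  assumes "parabolic UNIV X P"
  shows "adjacency_matrix P \<in> adjacency_algebra X"
  using adjacency_Union_in_algebra[of "{R \<in> X. R \<subseteq> P}"] parabolic_Union_eq[OF assms] by auto

lemma averaging_in_algebra:
  assumes "parabolic UNIV X P"
  shows "averaging_matrix P \<in> adjacency_algebra X"
  unfolding averaging_matrix_def by (intro algebra_scale parabolic_in_algebra assms)

lemma card_parabolic_class:
  "parabolic UNIV X P \<Longrightarrow> card (P `` {\<alpha>}) = valency UNIV P"
  by (intro card_Image_eq_valency parabolic_in_algebra)

lemma valency_parabolic_pos:
  assumes "parabolic UNIV X P"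
  shows "0 < valency UNIV P"
proof -
  have "P `` {undefined} \<noteq> {}"
    using assms by (auto simp: parabolic_def equiv_def refl_on_def)
  then show ?thesis
    using card_parabolic_class[OF assms, of undefined] by (metis card_gt_0_iff finite)
qed

lemma adjacency_eq_averaging:
  assumes "parabolic UNIV X P"
  shows "adjacency_matrix P = mat_scale (of_nat (valency UNIV P)) (averaging_matrix P)"
  using valency_parabolic_pos[OF assms] by (simp add: averaging_matrix_def)

lemma card_quotient_parabolic:
  assumes "parabolic UNIV X P"
  shows "card (UNIV // P) * valency UNIV P = CARD('n)"
proof -
  have P: "equiv UNIV P"
    using assms by (simp add: parabolic_def)
  have "CARD('n) = (\<Sum>\<Delta>\<in>UNIV // P. card \<Delta>)"
    by (rule product_partition[OF partition_on_quotient[OF P]]) simp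
  also have "\<dots> = (\<Sum>\<Delta>\<in>UNIV // P. valency UNIV P)"
    by (rule sum.cong) (auto elim!: quotientE simp: card_parabolic_class[OF assms])
  finally show ?thesis
    by simp
qed

lemma trace_averaging:
  assumes "parabolic UNIV X P"
  shows "trace (averaging_matrix P) = of_nat (card (UNIV // P))"
proof -
  have "(x, x) \<in> P" for x
    using assms by (auto simp: parabolic_def equiv_def refl_on_def)
  then have "trace (averaging_matrix P) = of_nat CARD('n) / of_nat (valency UNIV P)"
    by (simp add: averaging_matrix_def trace_def)
  then show ?thesis
    using valency_parabolic_pos[OF assms] by (simp flip: card_quotient_parabolic[OF assms])
qed

lemma averaging_mult_eq_iff:
  fixes A :: "complex^'n^'n"
  assumes "parabolic UNIV X P"
  shows "averaging_matrix P ** A = A \<longleftrightarrow> (\<forall>\<alpha> \<alpha>' \<beta>. (\<alpha>, \<alpha>') \<in> P \<longrightarrow> A $ \<alpha> $ \<beta> = A $ \<alpha>' $ \<beta>)"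
proof (intro iffI allI impI)
  have P: "equiv UNIV P"
    using assms by (simp add: parabolic_def)
  fix \<alpha> \<alpha>' \<beta> assume A: "averaging_matrix P ** A = A" and "(\<alpha>, \<alpha>') \<in> P"
  have "(averaging_matrix P ** A) $ \<alpha> $ \<beta> = (averaging_matrix P ** A) $ \<alpha>' $ \<beta>"
    by (simp only: averaging_mult_entry equiv_class_eq[OF P \<open>(\<alpha>, \<alpha>') \<in> P\<close>])
  then show "A $ \<alpha> $ \<beta> = A $ \<alpha>' $ \<beta>"
    by (simp only: A)
next
  assume const: "\<forall>\<alpha> \<alpha>' \<beta>. (\<alpha>, \<alpha>') \<in> P \<longrightarrow> A $ \<alpha> $ \<beta> = A $ \<alpha>' $ \<beta>"
  have "(\<Sum>\<gamma>\<in>P `` {\<alpha>}. A $ \<gamma> $ \<beta>) = of_nat (valency UNIV P) * A $ \<alpha> $ \<beta>" for \<alpha> \<beta>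
  proof -
    have "(\<Sum>\<gamma>\<in>P `` {\<alpha>}. A $ \<gamma> $ \<beta>) = (\<Sum>\<gamma>\<in>P `` {\<alpha>}. A $ \<alpha> $ \<beta>)"
      using const by (intro sum.cong) auto
    then show ?thesis
      by (simp add: card_parabolic_class[OF assms])
  qed
  then show "averaging_matrix P ** A = A"
    using valency_parabolic_pos[OF assms] by (simp add: vec_eq_iff averaging_mult_entry)
qed

lemma averaging_fine_mult_coarse:
  assumes P: "parabolic UNIV X P" and Q: "parabolic UNIV X Q" and "P \<subseteq> Q"
  shows "averaging_matrix P ** averaging_matrix Q = averaging_matrix Q"
  unfolding averaging_mult_eq_iff[OF P]
proof (intro allI impI)
  fix \<alpha> \<alpha>' \<beta> assume "(\<alpha>, \<alpha>') \<in> P"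
  then have "Q `` {\<alpha>} = Q `` {\<alpha>'}"
    using Q \<open>P \<subseteq> Q\<close> equiv_class_eq[of UNIV Q \<alpha> \<alpha>'] by (auto simp: parabolic_def)
  then have "(\<alpha>, \<beta>) \<in> Q \<longleftrightarrow> (\<alpha>', \<beta>) \<in> Q"
    by blast
  then show "averaging_matrix Q $ \<alpha> $ \<beta> = averaging_matrix Q $ \<alpha>' $ \<beta>"
    by (simp add: averaging_matrix_def)
qed

lemma averaging_hadamard:
  assumes "parabolic UNIV X P" "averaging_matrix P ** M = M"
  shows "averaging_matrix P ** hadamard M M' = hadamard M (averaging_matrix P ** M')"
proof -
  have "(\<Sum>\<gamma>\<in>P `` {\<alpha>}. M $ \<gamma> $ \<beta> * M' $ \<gamma> $ \<beta>) = M $ \<alpha> $ \<beta> * (\<Sum>\<gamma>\<in>P `` {\<alpha>}. M' $ \<gamma> $ \<beta>)" for \<alpha> \<beta>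
    using assms(2) unfolding averaging_mult_eq_iff[OF assms(1)] sum_distrib_left
    by (intro sum.cong) auto
  then show ?thesis
    by (simp add: vec_eq_iff averaging_mult_entry)
qed

lemma block_algebra_inject:
  assumes P: "parabolic UNIV X P" and Q: "parabolic UNIV X Q"
  shows "block_algebra X P = block_algebra X Q \<longleftrightarrow> P = Q"
proof
  assume eq: "block_algebra X P = block_algebra X Q"
  have equiv: "equiv UNIV P" "equiv UNIV Q"
    using P Q by (simp_all add: parabolic_def)
  have "adjacency_matrix P \<in> block_algebra X P" "adjacency_matrix Q \<in> block_algebra X Q"
    using P Q equiv
    by (simp_all add: block_algebra_def parabolic_in_algebra
        constant_on_blocks_adjacency_matrix_self)
  then have "constant_on_blocks Q (adjacency_matrix P)" "constant_on_blocks P (adjacency_matrix Q)"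
    using eq by (auto simp: block_algebra_def)
  then show "P = Q"
    using equiv subset_if_constant_on_blocks_adjacency_matrix by blast
qed simp

lemma index_parabolic_eq:
  assumes "parabolic UNIV X P" "cmat.span (Es ` I) = block_algebra X P"
  shows "index_parabolic X Es I = P"
  unfolding index_parabolic_def
  using assms block_algebra_inject by (intro the_equality) (auto simp flip: block_algebra_def)

lemma hadamard_subalgebra_block_algebra:
  assumes "parabolic UNIV X P"
  shows "hadamard_subalgebra X (block_algebra X P)"
proof -
  have P: "equiv UNIV P"
    using assms by (simp add: parabolic_def)
  have "cmat.subspace (block_algebra X P)"
    unfolding block_algebra_def constant_on_blocks_iff[OF P]
    by (rule cmat.subspaceI)
      (auto intro: cmat.subspace_0[OF subspace_algebra] algebra_add algebra_scale)
  then show ?thesis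
    unfolding hadamard_subalgebra_def block_algebra_def constant_on_blocks_iff[OF P]
    by (auto intro: all_ones_in_algebra hadamard_in_algebra)
qed

end

locale sym_scheme =
  fixes X :: "('n::finite \<times> 'n) set set"
  assumes symmetric: "symmetric_scheme UNIV X"
begin

sublocale scheme
  using symmetric by unfold_locales (simp add: symmetric_scheme_def)

lemma relation_symmetric: "R \<in> X \<Longrightarrow> (\<alpha>, \<beta>) \<in> R \<longleftrightarrow> (\<beta>, \<alpha>) \<in> R"
  using symmetric unfolding symmetric_scheme_def by (metis converse_iff)

lemma algebra_symmetric:
  assumes "A \<in> adjacency_algebra X"
  shows "A $ \<alpha> $ \<beta> = A $ \<beta> $ \<alpha>"
proof -
  obtain R where R: "R \<in> X" "(\<alpha>, \<beta>) \<in> R"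
    using Union_relations by (metis UNIV_I UnionE)
  moreover from this have "(\<beta>, \<alpha>) \<in> R"
    using relation_symmetric by blast
  ultimately show ?thesis
    by (rule algebra_constant[OF assms])
qed

lemma algebra_commute:
  assumes "A \<in> adjacency_algebra X" "B \<in> adjacency_algebra X"
  shows "A ** B = B ** A"
proof -
  have "(A ** B) $ \<alpha> $ \<beta> = (B ** A) $ \<alpha> $ \<beta>" for \<alpha> \<beta>
  proof -
    have "(A ** B) $ \<alpha> $ \<beta> = (A ** B) $ \<beta> $ \<alpha>"
      by (intro algebra_symmetric mult_in_algebra assms)
    also have "\<dots> = (B ** A) $ \<alpha> $ \<beta>"
      unfolding matrix_matrix_mult_def
      using algebra_symmetric[OF assms(1)] algebra_symmetric[OF assms(2)]
      by (auto intro!: sum.cong simp: mult.commute)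
    finally show ?thesis .
  qed
  then show ?thesis
    by (simp add: vec_eq_iff)
qed

lemma commutative: "commutative_scheme UNIV X"
  unfolding commutative_scheme_def
proof (intro conjI ballI)
  fix R S T assume RST: "R \<in> X" "S \<in> X" "T \<in> X"
  obtain \<alpha> \<beta> where T: "(\<alpha>, \<beta>) \<in> T"
    using relation_nonempty[OF RST(3)] by auto
  have "(adjacency_matrix R ** adjacency_matrix S) $ \<alpha> $ \<beta> =
      ((adjacency_matrix S ** adjacency_matrix R) $ \<alpha> $ \<beta> :: complex)"
    using algebra_commute adjacency_in_algebra RST by metis
  then show "intersection_number R S T = intersection_number S R T"
    using RST T by (simp add: adjacency_mult_adjacency_entry intersection_number_eq)
qed (rule association)

lemma averaging_coarse_mult_fine:
  assumes "parabolic UNIV X P" "parabolic UNIV X Q" "P \<subseteq> Q"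
  shows "averaging_matrix Q ** averaging_matrix P = averaging_matrix Q"
  using averaging_fine_mult_coarse[OF assms] algebra_commute averaging_in_algebra assms(1,2)
  by metis

lemma block_algebra_eq_averaging:
  assumes P: "parabolic UNIV X P"
  shows "block_algebra X P = {A \<in> adjacency_algebra X. averaging_matrix P ** A = A}"
proof -
  have equiv_P: "equiv UNIV P"
    using P by (simp add: parabolic_def)
  have "constant_on_blocks P A \<longleftrightarrow> averaging_matrix P ** A = A" if A: "A \<in> adjacency_algebra X" for A
  proof
    assume "constant_on_blocks P A"
    then show "averaging_matrix P ** A = A"
      using equiv_P unfolding constant_on_blocks_iff[OF equiv_P] averaging_mult_eq_iff[OF P]
      by (auto simp: equiv_def refl_on_def)
  next
    assume "averaging_matrix P ** A = A"
    then have rows: "A $ \<alpha> $ \<beta> = A $ \<alpha>' $ \<beta>" if "(\<alpha>, \<alpha>') \<in> P" for \<alpha> \<alpha>' \<beta>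
      using that averaging_mult_eq_iff[OF P] by blast
    show "constant_on_blocks P A"
      unfolding constant_on_blocks_iff[OF equiv_P]
    proof (intro allI impI)
      fix \<alpha> \<alpha>' \<beta> \<beta>' assume "(\<alpha>, \<alpha>') \<in> P" "(\<beta>, \<beta>') \<in> P"
      then have "A $ \<alpha> $ \<beta> = A $ \<alpha>' $ \<beta>" "A $ \<beta> $ \<alpha>' = A $ \<beta>' $ \<alpha>'"
        using rows by blast+
      then show "A $ \<alpha> $ \<beta> = A $ \<alpha>' $ \<beta>'"
        using algebra_symmetric[OF A] by metis
    qed
  qed
  then show ?thesis
    by (auto simp: block_algebra_def)
qed

lemma linked_mono:
  assumes "parabolic UNIV X P" "parabolic UNIV X Q" "P \<subseteq> Q" "linked Q M M'"
  shows "linked P M M'"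
proof -
  have "averaging_matrix Q ** hadamard M M' =
      averaging_matrix Q ** (averaging_matrix P ** hadamard M M')"
    by (simp add: matrix_mul_assoc averaging_coarse_mult_fine[OF assms(1-3)])
  then show ?thesis
    using assms(4) by (auto simp: linked_def)
qed

lemma sum_diagonal_hadamard:
  assumes "M \<in> adjacency_algebra X"
  shows "(\<Sum>\<gamma>\<in>UNIV. hadamard M M' $ \<gamma> $ \<alpha>) = (M ** M') $ \<alpha> $ \<alpha>"
  using algebra_symmetric[OF assms] by (simp add: matrix_matrix_mult_def)

lemma linked_idempotent_self:
  assumes "parabolic UNIV X P" "M \<in> adjacency_algebra X" "M ** M = M" "M \<noteq> 0"
  shows "linked P M M"
proof (rule linked_mono[OF assms(1) parabolic_UNIV subset_UNIV])
  obtain \<alpha> where "M $ \<alpha> $ \<alpha> \<noteq> 0"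
    using trace_idempotent_neq_0[OF assms(3,4)] unfolding trace_def by (meson sum.neutral)
  then have "(averaging_matrix UNIV ** hadamard M M) $ \<alpha> $ \<alpha> \<noteq> 0"
    using sum_diagonal_hadamard[OF assms(2), of M \<alpha>] assms(3)
    by (simp add: averaging_mult_entry valency_UNIV Image_singleton)
  then show "linked UNIV M M"
    unfolding linked_def by force
qed

end

section \<open>Wreath products\<close>

definition restrict_relations :: "'a set \<Rightarrow> ('a \<times> 'a) set set \<Rightarrow> ('a \<times> 'a) set set" where
  "restrict_relations \<Delta> X = (\<inter>) (\<Delta> \<times> \<Delta>) ` X - {{}}"

definition block_closed :: "('a \<times> 'a) set \<Rightarrow> ('a \<times> 'a) set \<Rightarrow> bool" where
  "block_closed E R \<longleftrightarrow>
    (\<forall>\<alpha> \<alpha>' \<beta> \<beta>'. (\<alpha>, \<alpha>') \<in> E \<longrightarrow> (\<beta>, \<beta>') \<in> E \<longrightarrow> (\<alpha>, \<beta>) \<in> R \<longrightarrow> (\<alpha>', \<beta>') \<in> R)"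

lemma block_closedD:
  "block_closed E R \<Longrightarrow> (\<alpha>, \<alpha>') \<in> E \<Longrightarrow> (\<beta>, \<beta>') \<in> E \<Longrightarrow> (\<alpha>, \<beta>) \<in> R \<Longrightarrow> (\<alpha>', \<beta>') \<in> R"
  by (simp add: block_closed_def)

lemma block_closed_equiv:
  assumes "equiv UNIV F" "E \<subseteq> F"
  shows "block_closed E F"
proof -
  have "F `` {\<alpha>} = F `` {\<alpha>'}" if "(\<alpha>, \<alpha>') \<in> E" for \<alpha> \<alpha>'
    using that assms equiv_class_eq by fast
  then show ?thesis
    by (simp add: block_closed_def equiv_class_eq_iff[OF assms(1)])
qed

lemma block_closed_diff:
  assumes "sym E" "block_closed E R" "block_closed E Q"
  shows "block_closed E (R - Q)"
  using assms unfolding block_closed_def sym_def by blast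

definition transversal :: "('a \<times> 'a) set \<Rightarrow> 'a set \<Rightarrow> bool" where
  "transversal E \<Gamma> \<longleftrightarrow> (\<forall>x. \<exists>!y. y \<in> \<Gamma> \<and> (x, y) \<in> E)"

lemma transversal_exists:
  assumes "equiv UNIV E"
  obtains \<Gamma> where "transversal E \<Gamma>"
proof
  define rep where "rep \<Delta> = (SOME x. x \<in> \<Delta>)" for \<Delta> :: "'a set"
  have rep: "(x, rep (E `` {x})) \<in> E" for x
    unfolding rep_def using equiv_class_self[OF assms, of x]
    by (metis Image_singleton_iff UNIV_I someI)
  have "rep (E `` {z}) = rep (E `` {x})" if "(x, rep (E `` {z})) \<in> E" for x z
    using equiv_class_eq[OF assms rep[of z]] equiv_class_eq[OF assms that] by simp
  then show "transversal E (range (\<lambda>x. rep (E `` {x})))"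
    unfolding transversal_def by (intro allI ex1I[of _ "rep (E `` {_})"]) (auto simp: rep)
qed

lemma transversal_eqI:
  assumes "transversal E \<Gamma>" "equiv UNIV E" "x \<in> \<Gamma>" "y \<in> \<Gamma>" "(x, y) \<in> E"
  shows "x = y"
proof -
  have "(x, x) \<in> E"
    using assms(2) by (auto simp: equiv_def refl_on_def)
  then show ?thesis
    using assms(1,3-5) unfolding transversal_def by blast
qed

lemma transversal_inter_block_closed_nonempty:
  assumes "transversal E \<Gamma>" "block_closed E R" "R \<noteq> {}"
  shows "(\<Gamma> \<times> \<Gamma>) \<inter> R \<noteq> {}"
proof -
  obtain \<alpha> \<beta> where "(\<alpha>, \<beta>) \<in> R"
    using assms(3) by auto
  moreover obtain x y where "x \<in> \<Gamma>" "(\<alpha>, x) \<in> E" "y \<in> \<Gamma>" "(\<beta>, y) \<in> E"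
    using assms(1) unfolding transversal_def by blast
  ultimately show ?thesis
    using block_closedD[OF assms(2)] by blast
qed

lemma card_transversal_ge_2:
  fixes E :: "('a::finite \<times> 'a) set"
  assumes "equiv UNIV E" "transversal E \<Gamma>" "E \<noteq> UNIV"
  shows "2 \<le> card \<Gamma>"
proof -
  obtain u v where "(u, v) \<notin> E"
    using assms(3) by auto
  moreover obtain x y where xy: "x \<in> \<Gamma>" "(u, x) \<in> E" "y \<in> \<Gamma>" "(v, y) \<in> E"
    using assms(2) unfolding transversal_def by blast
  ultimately have "x \<noteq> y"
    by (auto simp: equiv_class_eq_iff[OF assms(1)])
  then show ?thesis
    using card_mono[of \<Gamma> "{x, y}"] xy by simp
qed

lemma map_prod_image_eqI:
  assumes "bij_betw \<phi> A UNIV" "W \<subseteq> A \<times> A"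
    and "\<And>p q. p \<in> A \<Longrightarrow> q \<in> A \<Longrightarrow> (p, q) \<in> W \<longleftrightarrow> (\<phi> p, \<phi> q) \<in> R"
  shows "map_prod \<phi> \<phi> ` W = R"
proof (intro equalityI subrelI)
  fix y z assume "(y, z) \<in> R"
  moreover obtain p q where "p \<in> A" "q \<in> A" "y = \<phi> p" "z = \<phi> q"
    using bij_betw_imp_surj_on[OF assms(1)] by (metis UNIV_I imageE)
  ultimately show "(y, z) \<in> map_prod \<phi> \<phi> ` W"
    using assms(3) by force
qed (use assms(2,3) in auto)

context scheme
begin

lemma association_scheme_restrict:
  assumes "\<Delta> \<noteq> {}"
    and const: "\<And>R S T. R \<in> X \<Longrightarrow> S \<in> X \<Longrightarrow> T \<in> X \<Longrightarrow> \<exists>p. \<forall>\<alpha>\<in>\<Delta>. \<forall>\<beta>\<in>\<Delta>. (\<alpha>, \<beta>) \<in> T \<longrightarrow>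
      card {\<gamma> \<in> \<Delta>. (\<alpha>, \<gamma>) \<in> R \<and> (\<gamma>, \<beta>) \<in> S} = p"
  shows "association_scheme \<Delta> (restrict_relations \<Delta> X)"
  unfolding association_scheme_def
proof (intro conjI ballI)
  show "partition_on (\<Delta> \<times> \<Delta>) (restrict_relations \<Delta> X)"
    using partition_on_restrict[OF partition, of "\<Delta> \<times> \<Delta>"] by (simp add: restrict_relations_def)
  have "Id_on \<Delta> = (\<Delta> \<times> \<Delta>) \<inter> Id"
    by auto
  then show "Id_on \<Delta> \<in> restrict_relations \<Delta> X"
    using Id_in_relations assms(1) by (auto simp: restrict_relations_def)
next
  fix R assume "R \<in> restrict_relations \<Delta> X"
  then obtain R' where R: "R' \<in> X" "R = (\<Delta> \<times> \<Delta>) \<inter> R'" "R \<noteq> {}"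
    by (auto simp: restrict_relations_def)
  moreover have "R\<inverse> = (\<Delta> \<times> \<Delta>) \<inter> R'\<inverse>" "R\<inverse> \<noteq> {}"
    using R(2,3) by auto
  ultimately show "R\<inverse> \<in> restrict_relations \<Delta> X"
    using converse_in_relations by (simp add: restrict_relations_def)
next
  fix R S T assume "R \<in> restrict_relations \<Delta> X" "S \<in> restrict_relations \<Delta> X"
    "T \<in> restrict_relations \<Delta> X"
  then obtain R' S' T' where in_X: "R' \<in> X" "S' \<in> X" "T' \<in> X"
    and R: "R = (\<Delta> \<times> \<Delta>) \<inter> R'" and S: "S = (\<Delta> \<times> \<Delta>) \<inter> S'" and T: "T = (\<Delta> \<times> \<Delta>) \<inter> T'"
    by (auto simp: restrict_relations_def)
  obtain p where p: "\<forall>\<alpha>\<in>\<Delta>. \<forall>\<beta>\<in>\<Delta>. (\<alpha>, \<beta>) \<in> T' \<longrightarrow> card {\<gamma> \<in> \<Delta>. (\<alpha>, \<gamma>) \<in> R' \<and> (\<gamma>, \<beta>) \<in> S'} = p"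
    using const[OF in_X] by blast
  have "{\<gamma>. (\<alpha>, \<gamma>) \<in> R \<and> (\<gamma>, \<beta>) \<in> S} = {\<gamma> \<in> \<Delta>. (\<alpha>, \<gamma>) \<in> R' \<and> (\<gamma>, \<beta>) \<in> S'}" if "(\<alpha>, \<beta>) \<in> T" for \<alpha> \<beta>
    using that by (auto simp: R S T)
  then have "\<forall>(\<alpha>, \<beta>)\<in>T. card {\<gamma>. (\<alpha>, \<gamma>) \<in> R \<and> (\<gamma>, \<beta>) \<in> S} = p"
    using p by (auto simp: T)
  then show "\<exists>p. \<forall>(\<alpha>, \<beta>)\<in>T. card {\<gamma>. (\<alpha>, \<gamma>) \<in> R \<and> (\<gamma>, \<beta>) \<in> S} = p" ..
qed simp

lemma association_scheme_parabolic_class: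
  assumes "parabolic UNIV X E"
  shows "association_scheme (E `` {\<delta>}) (restrict_relations (E `` {\<delta>}) X)"
proof (rule association_scheme_restrict)
  have E: "equiv UNIV E"
    using assms by (simp add: parabolic_def)
  show "E `` {\<delta>} \<noteq> {}"
    using equiv_class_self[OF E, of \<delta>] by blast
  have class_iff: "\<gamma> \<in> E `` {\<delta>} \<longleftrightarrow> (\<alpha>, \<gamma>) \<in> E" if "\<alpha> \<in> E `` {\<delta>}" for \<alpha> \<gamma>
    using that by (auto simp: equiv_class_eq_iff[OF E])
  fix R S T assume RST: "R \<in> X" "S \<in> X" "T \<in> X"
  obtain p where p: "\<forall>(\<alpha>, \<beta>)\<in>T. card {\<gamma>. (\<alpha>, \<gamma>) \<in> R \<and> (\<gamma>, \<beta>) \<in> S} = p"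
    using association RST unfolding association_scheme_def by meson
  show "\<exists>p. \<forall>\<alpha>\<in>E `` {\<delta>}. \<forall>\<beta>\<in>E `` {\<delta>}. (\<alpha>, \<beta>) \<in> T \<longrightarrow>
    card {\<gamma> \<in> E `` {\<delta>}. (\<alpha>, \<gamma>) \<in> R \<and> (\<gamma>, \<beta>) \<in> S} = p"
  proof (cases "R \<subseteq> E")
    case True
    then have "{\<gamma> \<in> E `` {\<delta>}. (\<alpha>, \<gamma>) \<in> R \<and> (\<gamma>, \<beta>) \<in> S} = {\<gamma>. (\<alpha>, \<gamma>) \<in> R \<and> (\<gamma>, \<beta>) \<in> S}"
      if "\<alpha> \<in> E `` {\<delta>}" for \<alpha> \<beta>
      using class_iff[OF that] by blast
    then show ?thesis
      using p by (intro exI[of _ p]) auto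
  next
    case False
    then have "R \<inter> E = {}"
      using parabolic_relation_cases[OF assms RST(1)] by blast
    then have "{\<gamma> \<in> E `` {\<delta>}. (\<alpha>, \<gamma>) \<in> R \<and> (\<gamma>, \<beta>) \<in> S} = {}" if "\<alpha> \<in> E `` {\<delta>}" for \<alpha> \<beta>
      using class_iff[OF that] by blast
    then show ?thesis
      by (intro exI[of _ 0]) auto
  qed
qed

lemma card_paths_block_closed:
  assumes E: "parabolic UNIV X E" and \<Gamma>: "transversal E \<Gamma>" and R: "block_closed E R"
    and S: "block_closed E S"
  shows "card {\<gamma>. (\<alpha>, \<gamma>) \<in> R \<and> (\<gamma>, \<beta>) \<in> S} = valency UNIV E * card {\<gamma> \<in> \<Gamma>. (\<alpha>, \<gamma>) \<in> R \<and> (\<gamma>, \<beta>) \<in> S}"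
proof -
  let ?C = "{\<gamma> \<in> \<Gamma>. (\<alpha>, \<gamma>) \<in> R \<and> (\<gamma>, \<beta>) \<in> S}"
  have equiv_E: "equiv UNIV E"
    using E by (simp add: parabolic_def)
  then have refl: "(x, x) \<in> E" and sym: "(x, y) \<in> E \<Longrightarrow> (y, x) \<in> E" for x y
    by (auto simp: equiv_def refl_on_def sym_def)
  have blocks: "(\<alpha>, \<gamma>) \<in> R \<and> (\<gamma>, \<beta>) \<in> S \<Longrightarrow> (\<alpha>, \<gamma>') \<in> R \<and> (\<gamma>', \<beta>) \<in> S" if "(\<gamma>, \<gamma>') \<in> E" for \<gamma> \<gamma>'
    using block_closedD[OF R refl that] block_closedD[OF S that refl] by blast
  have "{\<gamma>. (\<alpha>, \<gamma>) \<in> R \<and> (\<gamma>, \<beta>) \<in> S} = (\<Union>x\<in>?C. E `` {x})"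
  proof (intro equalityI subsetI)
    fix \<gamma> assume \<gamma>: "\<gamma> \<in> {\<gamma>. (\<alpha>, \<gamma>) \<in> R \<and> (\<gamma>, \<beta>) \<in> S}"
    obtain x where "x \<in> \<Gamma>" "(\<gamma>, x) \<in> E"
      using \<Gamma> unfolding transversal_def by blast
    then show "\<gamma> \<in> (\<Union>x\<in>?C. E `` {x})"
      using \<gamma> blocks sym by blast
  qed (use blocks in blast)
  moreover have "E `` {x} \<inter> E `` {y} = {}" if "x \<in> ?C" "y \<in> ?C" "x \<noteq> y" for x y
    using that transversal_eqI[OF \<Gamma> equiv_E, of x y]
      quotient_disj[OF equiv_E, of "E `` {x}" "E `` {y}"]
      equiv_class_eq_iff[OF equiv_E, of x y] by (auto simp: quotientI)
  ultimately have "card {\<gamma>. (\<alpha>, \<gamma>) \<in> R \<and> (\<gamma>, \<beta>) \<in> S} = (\<Sum>x\<in>?C. card (E `` {x}))"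
    by (simp add: card_UN_disjoint)
  then show ?thesis
    by (simp add: card_parabolic_class[OF E])
qed

lemma transversal_inter_relation_eq_empty:
  assumes "equiv UNIV E" "transversal E \<Gamma>" "R \<in> X" "R \<subseteq> E" "R \<noteq> Id"
  shows "(\<Gamma> \<times> \<Gamma>) \<inter> R = {}"
proof -
  have "(x, x) \<notin> R" for x
    using relation_eqI[OF assms(3) Id_in_relations, of "(x, x)"] assms(5) by auto
  moreover have "x = y" if "x \<in> \<Gamma>" "y \<in> \<Gamma>" "(x, y) \<in> R" for x y
    using that transversal_eqI[OF assms(2,1)] assms(4) by blast
  ultimately show ?thesis
    by blast
qed

lemma block_closed_lift:
  assumes E: "parabolic UNIV X E" and \<Gamma>: "transversal E \<Gamma>"
    and R: "R \<in> X" "\<not> R \<subseteq> E \<Longrightarrow> block_closed E R"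
  obtains Q where "adjacency_matrix Q \<in> adjacency_algebra X" "block_closed E Q"
    "\<And>\<alpha> \<beta>. \<alpha> \<in> \<Gamma> \<Longrightarrow> \<beta> \<in> \<Gamma> \<Longrightarrow> (\<alpha>, \<beta>) \<in> Q \<longleftrightarrow> (\<alpha>, \<beta>) \<in> R"
proof -
  have equiv_E: "equiv UNIV E"
    using E by (simp add: parabolic_def)
  consider "R = Id" | "R \<subseteq> E" "R \<noteq> Id" | "\<not> R \<subseteq> E"
    by blast
  then show thesis
  proof cases
    assume "R = Id"
    then have "(\<alpha>, \<beta>) \<in> E \<longleftrightarrow> (\<alpha>, \<beta>) \<in> R" if "\<alpha> \<in> \<Gamma>" "\<beta> \<in> \<Gamma>" for \<alpha> \<beta>
      using that transversal_eqI[OF \<Gamma> equiv_E] equiv_E by (auto simp: equiv_def refl_on_def)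
    then show ?thesis
      by (rule that[OF parabolic_in_algebra[OF E] block_closed_equiv[OF equiv_E subset_refl]])
  next
    assume "R \<subseteq> E" "R \<noteq> Id"
    then have "(\<alpha>, \<beta>) \<in> {} \<longleftrightarrow> (\<alpha>, \<beta>) \<in> R" if "\<alpha> \<in> \<Gamma>" "\<beta> \<in> \<Gamma>" for \<alpha> \<beta>
      using that transversal_inter_relation_eq_empty[OF equiv_E \<Gamma> R(1)] by blast
    moreover have "adjacency_matrix {} \<in> adjacency_algebra X"
      using adjacency_Union_in_algebra[of "{}"] by simp
    ultimately show ?thesis
      using that[of "{}"] by (simp add: block_closed_def)
  next
    assume "\<not> R \<subseteq> E"
    then show ?thesis
      using that[of R] adjacency_in_algebra R by simp
  qed
qed

lemma association_scheme_transversal: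
  assumes E: "parabolic UNIV X E" and \<Gamma>: "transversal E \<Gamma>"
    and closed: "\<And>R. R \<in> X \<Longrightarrow> \<not> R \<subseteq> E \<Longrightarrow> block_closed E R"
  shows "association_scheme \<Gamma> (restrict_relations \<Gamma> X)"
proof (rule association_scheme_restrict)
  show "\<Gamma> \<noteq> {}"
    using \<Gamma> by (auto simp: transversal_def)
  fix R S T assume RST: "R \<in> X" "S \<in> X" "T \<in> X"
  obtain Q where Q: "adjacency_matrix Q \<in> adjacency_algebra X" "block_closed E Q"
    "\<And>\<alpha> \<beta>. \<alpha> \<in> \<Gamma> \<Longrightarrow> \<beta> \<in> \<Gamma> \<Longrightarrow> (\<alpha>, \<beta>) \<in> Q \<longleftrightarrow> (\<alpha>, \<beta>) \<in> R"
    using block_closed_lift[OF E \<Gamma> RST(1)] closed[OF RST(1)] by metis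
  obtain P where P: "adjacency_matrix P \<in> adjacency_algebra X" "block_closed E P"
    "\<And>\<alpha> \<beta>. \<alpha> \<in> \<Gamma> \<Longrightarrow> \<beta> \<in> \<Gamma> \<Longrightarrow> (\<alpha>, \<beta>) \<in> P \<longleftrightarrow> (\<alpha>, \<beta>) \<in> S"
    using block_closed_lift[OF E \<Gamma> RST(2)] closed[OF RST(2)] by metis
  obtain \<alpha>\<^sub>0 \<beta>\<^sub>0 where T: "(\<alpha>\<^sub>0, \<beta>\<^sub>0) \<in> T"
    using relation_nonempty[OF RST(3)] by auto
  define p where "p = card {\<gamma> \<in> \<Gamma>. (\<alpha>\<^sub>0, \<gamma>) \<in> Q \<and> (\<gamma>, \<beta>\<^sub>0) \<in> P}"
  have "card {\<gamma> \<in> \<Gamma>. (\<alpha>, \<gamma>) \<in> R \<and> (\<gamma>, \<beta>) \<in> S} = p" if "\<alpha> \<in> \<Gamma>" "\<beta> \<in> \<Gamma>" "(\<alpha>, \<beta>) \<in> T" for \<alpha> \<beta>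
  proof -
    have "{\<gamma> \<in> \<Gamma>. (\<alpha>, \<gamma>) \<in> R \<and> (\<gamma>, \<beta>) \<in> S} = {\<gamma> \<in> \<Gamma>. (\<alpha>, \<gamma>) \<in> Q \<and> (\<gamma>, \<beta>) \<in> P}"
      using Q(3) P(3) that by blast
    moreover have "valency UNIV E * card {\<gamma> \<in> \<Gamma>. (\<alpha>, \<gamma>) \<in> Q \<and> (\<gamma>, \<beta>) \<in> P} = valency UNIV E * p"
      unfolding p_def card_paths_block_closed[OF E \<Gamma> Q(2) P(2), symmetric]
      by (rule card_paths_constant[OF Q(1) P(1) RST(3) that(3) T])
    ultimately show ?thesis
      using valency_parabolic_pos[OF E] by simp
  qed
  then show "\<exists>p. \<forall>\<alpha>\<in>\<Gamma>. \<forall>\<beta>\<in>\<Gamma>. (\<alpha>, \<beta>) \<in> T \<longrightarrow> card {\<gamma> \<in> \<Gamma>. (\<alpha>, \<gamma>) \<in> R \<and> (\<gamma>, \<beta>) \<in> S} = p"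
    by blast
qed

lemma transversal_coordinates:
  assumes E: "parabolic UNIV X E" and \<Gamma>: "transversal E \<Gamma>"
  obtains \<phi> where "bij_betw \<phi> (E `` {\<delta>} \<times> \<Gamma>) UNIV" "\<And>a x. a \<in> E `` {\<delta>} \<Longrightarrow> (x, \<phi> (a, x)) \<in> E"
proof -
  have equiv_E: "equiv UNIV E"
    using E by (simp add: parabolic_def)
  have "\<exists>h. bij_betw h (E `` {\<delta>}) (E `` {x})" for x
    by (rule finite_same_card_bij) (simp_all add: card_parabolic_class[OF E])
  then obtain h where h: "\<And>x. bij_betw (h x) (E `` {\<delta>}) (E `` {x})"
    by metis
  define \<phi> where "\<phi> = (\<lambda>(a, x). h x a)"
  have in_class: "(x, \<phi> (a, x)) \<in> E" if "a \<in> E `` {\<delta>}" for a x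
    using bij_betwE[OF h[of x]] that by (auto simp: \<phi>_def)
  have "bij_betw \<phi> (E `` {\<delta>} \<times> \<Gamma>) UNIV"
  proof (rule bij_betw_imageI)
    show "inj_on \<phi> (E `` {\<delta>} \<times> \<Gamma>)"
    proof (rule inj_onI, clarify)
      fix a x b y assume ab: "(\<delta>, a) \<in> E" "(\<delta>, b) \<in> E" "x \<in> \<Gamma>" "y \<in> \<Gamma>" "\<phi> (a, x) = \<phi> (b, y)"
      then have "(x, y) \<in> E"
        using in_class[of a x] in_class[of b y] by (simp add: equiv_class_eq_iff[OF equiv_E])
      then have "x = y"
        using transversal_eqI[OF \<Gamma> equiv_E] ab(3,4) by blast
      then show "a = b \<and> x = y"
        using ab bij_betw_imp_inj_on[OF h[of x]] by (auto simp: \<phi>_def dest: inj_onD)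
    qed
    have "z \<in> \<phi> ` (E `` {\<delta>} \<times> \<Gamma>)" for z
    proof -
      obtain x where x: "x \<in> \<Gamma>" "(z, x) \<in> E"
        using \<Gamma> unfolding transversal_def by blast
      then have "z \<in> h x ` (E `` {\<delta>})"
        using equiv_E bij_betw_imp_surj_on[OF h[of x]] by (auto simp: equiv_def sym_def)
      then show ?thesis
        using x(1) by (auto simp: \<phi>_def image_iff)
    qed
    then show "\<phi> ` (E `` {\<delta>} \<times> \<Gamma>) = UNIV"
      by blast
  qed
  then show thesis
    using that in_class by blast
qed

lemma relations_within_parabolic:
  assumes "parabolic UNIV X E" "E - Id \<in> X"
  shows "{R \<in> X. R \<subseteq> E} = {Id, E - Id}"
proof -
  have "R \<in> {Id, E - Id}" if R: "R \<in> X" "R \<subseteq> E" for R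
  proof -
    obtain p where "p \<in> R"
      using relation_nonempty[OF R(1)] by auto
    then show ?thesis
      using R(2) relation_eqI[OF R(1) Id_in_relations, of p] relation_eqI[OF R(1) assms(2), of p]
      by blast
  qed
  moreover have "Id \<subseteq> E"
    using assms(1) by (auto simp: parabolic_def equiv_def refl_on_def)
  ultimately show ?thesis
    using Id_in_relations assms(2) by blast
qed

lemma restrict_class_eq:
  assumes E: "parabolic UNIV X E" and "E - Id \<in> X"
  shows "restrict_relations (E `` {\<delta>}) X = (\<inter>) (E `` {\<delta>} \<times> E `` {\<delta>}) ` {Id, E - Id}"
proof -
  let ?\<Delta> = "E `` {\<delta>}"
  have equiv_E: "equiv UNIV E"
    using E by (simp add: parabolic_def)
  have \<Delta>: "\<delta> \<in> ?\<Delta>" "?\<Delta> \<times> ?\<Delta> \<subseteq> E"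
    using equiv_E by (auto simp: equiv_class_eq_iff[OF equiv_E])
  have "(E - Id) `` {\<delta>} \<noteq> {}"
    using valency_relation_pos[OF assms(2)]
      card_Image_eq_valency[OF adjacency_in_algebra[OF assms(2)], of \<delta>]
    by (metis card.empty less_irrefl)
  then have "(?\<Delta> \<times> ?\<Delta>) \<inter> (E - Id) \<noteq> {}" "(?\<Delta> \<times> ?\<Delta>) \<inter> Id \<noteq> {}"
    using \<Delta>(1) by blast+
  moreover have "R \<in> {Id, E - Id}" if "R \<in> X" "(?\<Delta> \<times> ?\<Delta>) \<inter> R \<noteq> {}" for R
    using that \<Delta>(2) parabolic_relation_cases[OF E that(1)] relations_within_parabolic[OF assms]
    by blast
  ultimately show ?thesis
    unfolding restrict_relations_def using Id_in_relations assms(2) by blast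
qed

lemma restrict_transversal_eq:
  assumes E: "parabolic UNIV X E" and \<Gamma>: "transversal E \<Gamma>"
    and closed: "\<And>R. R \<in> X \<Longrightarrow> \<not> R \<subseteq> E \<Longrightarrow> block_closed E R"
  shows "restrict_relations \<Gamma> X - {Id_on \<Gamma>} = (\<inter>) (\<Gamma> \<times> \<Gamma>) ` {R \<in> X. \<not> R \<subseteq> E}"
proof -
  have equiv_E: "equiv UNIV E"
    using E by (simp add: parabolic_def)
  have inside: "(\<Gamma> \<times> \<Gamma>) \<inter> R \<in> {{}, Id_on \<Gamma>}" if "R \<in> X" "R \<subseteq> E" for R
  proof (cases "R = Id")
    case False
    then show ?thesis
      using transversal_inter_relation_eq_empty[OF equiv_E \<Gamma> that] by simp
  qed auto
  have outside: "(\<Gamma> \<times> \<Gamma>) \<inter> R \<notin> {{}, Id_on \<Gamma>}" if R: "R \<in> X" "\<not> R \<subseteq> E" for R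
  proof -
    have "(\<Gamma> \<times> \<Gamma>) \<inter> R \<noteq> {}"
      using transversal_inter_block_closed_nonempty[OF \<Gamma> closed[OF R] relation_nonempty[OF R(1)]] .
    moreover have "R \<inter> E = {}"
      using parabolic_relation_cases[OF E R(1)] R(2) by simp
    moreover have "Id_on \<Gamma> \<subseteq> E"
      using equiv_E by (auto simp: equiv_def refl_on_def)
    ultimately show ?thesis
      by blast
  qed
  show ?thesis
  proof (intro equalityI subsetI)
    fix Q assume "Q \<in> restrict_relations \<Gamma> X - {Id_on \<Gamma>}"
    then obtain R where R: "R \<in> X" "Q = (\<Gamma> \<times> \<Gamma>) \<inter> R" "Q \<notin> {{}, Id_on \<Gamma>}"
      by (auto simp: restrict_relations_def)
    then have "\<not> R \<subseteq> E"
      using inside[of R] by auto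
    then show "Q \<in> (\<inter>) (\<Gamma> \<times> \<Gamma>) ` {R \<in> X. \<not> R \<subseteq> E}"
      using R(1,2) by simp
  next
    fix Q assume "Q \<in> (\<inter>) (\<Gamma> \<times> \<Gamma>) ` {R \<in> X. \<not> R \<subseteq> E}"
    then show "Q \<in> restrict_relations \<Gamma> X - {Id_on \<Gamma>}"
      using outside by (auto simp: restrict_relations_def)
  qed
qed

end

definition fibre_relation :: "'c set \<Rightarrow> ('b \<times> 'b) set \<Rightarrow> (('b \<times> 'c) \<times> ('b \<times> 'c)) set" where
  "fibre_relation \<Gamma> R = {((a, x), (b, x)) | a b x. (a, b) \<in> R \<and> x \<in> \<Gamma>}"

definition quotient_relation :: "'b set \<Rightarrow> ('c \<times> 'c) set \<Rightarrow> (('b \<times> 'c) \<times> ('b \<times> 'c)) set" where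
  "quotient_relation \<Delta> S = {((a, x), (b, y)) | a b x y. a \<in> \<Delta> \<and> b \<in> \<Delta> \<and> (x, y) \<in> S}"

lemma wreath_product_eq:
  "wreath_product \<Delta> Y \<Gamma> Z = fibre_relation \<Gamma> ` Y \<union> quotient_relation \<Delta> ` (Z - {Id_on \<Gamma>})"
  by (simp add: wreath_product_def fibre_relation_def quotient_relation_def)

lemma image_fibre_relation:
  assumes \<phi>: "bij_betw \<phi> (\<Delta> \<times> \<Gamma>) UNIV"
    and blocks: "\<And>a b x y. a \<in> \<Delta> \<Longrightarrow> b \<in> \<Delta> \<Longrightarrow> x \<in> \<Gamma> \<Longrightarrow> y \<in> \<Gamma> \<Longrightarrow> (\<phi> (a, x), \<phi> (b, y)) \<in> E \<longleftrightarrow> x = y"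
    and "\<Delta> \<times> \<Delta> \<subseteq> E" "R \<in> {Id, E - Id}"
  shows "map_prod \<phi> \<phi> ` fibre_relation \<Gamma> ((\<Delta> \<times> \<Delta>) \<inter> R) = R"
proof (rule map_prod_image_eqI[OF \<phi>])
  fix p q assume points: "p \<in> \<Delta> \<times> \<Gamma>" "q \<in> \<Delta> \<times> \<Gamma>"
  then have "\<phi> p = \<phi> q \<longleftrightarrow> p = q" "(\<phi> p, \<phi> q) \<in> E \<longleftrightarrow> snd p = snd q"
    using bij_betw_imp_inj_on[OF \<phi>] blocks by (auto simp: inj_on_def)
  moreover have "(p, q) \<in> fibre_relation \<Gamma> ((\<Delta> \<times> \<Delta>) \<inter> R) \<longleftrightarrow> snd p = snd q \<and> (fst p, fst q) \<in> R"
    using points by (auto simp: fibre_relation_def)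
  moreover have "(fst p, fst q) \<in> E"
    using points assms(3) by auto
  ultimately show "(p, q) \<in> fibre_relation \<Gamma> ((\<Delta> \<times> \<Delta>) \<inter> R) \<longleftrightarrow> (\<phi> p, \<phi> q) \<in> R"
    using assms(4) by (auto simp: prod_eq_iff)
qed (auto simp: fibre_relation_def)

lemma image_quotient_relation:
  assumes \<phi>: "bij_betw \<phi> (\<Delta> \<times> \<Gamma>) UNIV" and "\<And>a x. a \<in> \<Delta> \<Longrightarrow> (x, \<phi> (a, x)) \<in> E"
    and "equiv UNIV E" "block_closed E R"
  shows "map_prod \<phi> \<phi> ` quotient_relation \<Delta> ((\<Gamma> \<times> \<Gamma>) \<inter> R) = R"
proof (rule map_prod_image_eqI[OF \<phi>])
  fix p q assume points: "p \<in> \<Delta> \<times> \<Gamma>" "q \<in> \<Delta> \<times> \<Gamma>"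
  then have "(snd p, \<phi> p) \<in> E" "(snd q, \<phi> q) \<in> E"
    using assms(2) by auto
  moreover from this have "(\<phi> p, snd p) \<in> E" "(\<phi> q, snd q) \<in> E"
    using assms(3) by (auto simp: equiv_def sym_def)
  ultimately have "(snd p, snd q) \<in> R \<longleftrightarrow> (\<phi> p, \<phi> q) \<in> R"
    using block_closedD[OF assms(4)] by blast
  moreover have "(p, q) \<in> quotient_relation \<Delta> ((\<Gamma> \<times> \<Gamma>) \<inter> R) \<longleftrightarrow> (snd p, snd q) \<in> R"
    using points by (auto simp: quotient_relation_def)
  ultimately show "(p, q) \<in> quotient_relation \<Delta> ((\<Gamma> \<times> \<Gamma>) \<inter> R) \<longleftrightarrow> (\<phi> p, \<phi> q) \<in> R"
    by blast
qed (auto simp: quotient_relation_def)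

context scheme
begin

lemma relations_eq_wreath_product:
  assumes E: "parabolic UNIV X E" "E - Id \<in> X" and \<Gamma>: "transversal E \<Gamma>"
    and closed: "\<And>R. R \<in> X \<Longrightarrow> \<not> R \<subseteq> E \<Longrightarrow> block_closed E R"
    and \<phi>: "bij_betw \<phi> (E `` {\<delta>} \<times> \<Gamma>) UNIV" "\<And>a x. a \<in> E `` {\<delta>} \<Longrightarrow> (x, \<phi> (a, x)) \<in> E"
  shows "X = (`) (map_prod \<phi> \<phi>) `
    wreath_product (E `` {\<delta>}) (restrict_relations (E `` {\<delta>}) X) \<Gamma> (restrict_relations \<Gamma> X)"
proof -
  let ?\<Delta> = "E `` {\<delta>}"
  have equiv_E: "equiv UNIV E"
    using E(1) by (simp add: parabolic_def)
  have blocks: "(\<phi> (a, x), \<phi> (b, y)) \<in> E \<longleftrightarrow> x = y" if "a \<in> ?\<Delta>" "b \<in> ?\<Delta>" "x \<in> \<Gamma>" "y \<in> \<Gamma>" for a b x y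
    using \<phi>(2)[OF that(1), of x] \<phi>(2)[OF that(2), of y] transversal_eqI[OF \<Gamma> equiv_E that(3,4)]
    by (auto simp: equiv_class_eq_iff[OF equiv_E])
  have "?\<Delta> \<times> ?\<Delta> \<subseteq> E"
    by (auto simp: equiv_class_eq_iff[OF equiv_E])
  then have fibres: "(`) (map_prod \<phi> \<phi>) ` fibre_relation \<Gamma> ` (\<inter>) (?\<Delta> \<times> ?\<Delta>) ` {Id, E - Id} =
      {Id, E - Id}"
    using image_fibre_relation[OF \<phi>(1) blocks] by simp
  have "map_prod \<phi> \<phi> ` quotient_relation ?\<Delta> ((\<Gamma> \<times> \<Gamma>) \<inter> R) = R" if "R \<in> {R \<in> X. \<not> R \<subseteq> E}" for R
    using image_quotient_relation[OF \<phi> equiv_E closed[of R]] that by simp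
  then have quotients: "(`) (map_prod \<phi> \<phi>) ` quotient_relation ?\<Delta> ` (\<inter>) (\<Gamma> \<times> \<Gamma>) ` {R \<in> X. \<not> R \<subseteq> E}
      = {R \<in> X. \<not> R \<subseteq> E}"
    unfolding image_image by (rule trans[OF image_cong[OF refl, where g = "\<lambda>R. R"] image_ident])
  have transversal_relations: "restrict_relations \<Gamma> X - {Id_on \<Gamma>} = (\<inter>) (\<Gamma> \<times> \<Gamma>) ` {R \<in> X. \<not> R \<subseteq> E}"
    using restrict_transversal_eq[OF E(1) \<Gamma>] closed by simp
  have "X = {R \<in> X. R \<subseteq> E} \<union> {R \<in> X. \<not> R \<subseteq> E}"
    by blast
  then show ?thesis
    unfolding wreath_product_eq restrict_class_eq[OF E] transversal_relations image_Un fibres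
      quotients
      relations_within_parabolic[OF E] .
qed

lemma card_parabolic_class_ge_2:
  assumes "parabolic UNIV X E" "E - Id \<in> X"
  shows "2 \<le> card (E `` {\<alpha>})"
proof -
  obtain u v where "(u, v) \<in> E - Id"
    using relation_nonempty[OF assms(2)] by auto
  moreover have "(u, u) \<in> E"
    using assms(1) by (auto simp: parabolic_def equiv_def refl_on_def)
  ultimately have "card {u, v} = 2" "{u, v} \<subseteq> E `` {u}"
    by auto
  then show ?thesis
    using card_mono[of "E `` {u}" "{u, v}"] by (simp add: card_parabolic_class[OF assms(1)])
qed

lemma decomposable_if_block_closed:
  assumes E: "parabolic UNIV X E" "E - Id \<in> X" "E \<noteq> UNIV"
    and closed: "\<And>R. R \<in> X \<Longrightarrow> \<not> R \<subseteq> E \<Longrightarrow> block_closed E R"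
  shows "decomposable UNIV X"
proof -
  have equiv_E: "equiv UNIV E"
    using E(1) by (simp add: parabolic_def)
  obtain \<Gamma> where \<Gamma>: "transversal E \<Gamma>"
    using transversal_exists[OF equiv_E] .
  obtain \<phi> where \<phi>: "bij_betw \<phi> (E `` {undefined} \<times> \<Gamma>) UNIV"
    "\<And>a x. a \<in> E `` {undefined} \<Longrightarrow> (x, \<phi> (a, x)) \<in> E"
    using transversal_coordinates[OF E(1) \<Gamma>, where \<delta> = undefined] by blast
  show ?thesis
    unfolding decomposable_def
  proof (intro exI conjI)
    show "association_scheme (E `` {undefined}) (restrict_relations (E `` {undefined}) X)"
      by (rule association_scheme_parabolic_class[OF E(1)])
    show "association_scheme \<Gamma> (restrict_relations \<Gamma> X)"
      using association_scheme_transversal[OF E(1) \<Gamma>] closed by simp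
    show "bij_betw \<phi> (E `` {undefined} \<times> \<Gamma>) UNIV"
      by (rule \<phi>(1))
    show "X = (`) (map_prod \<phi> \<phi>) `
        wreath_product (E `` {undefined}) (restrict_relations (E `` {undefined}) X)
          \<Gamma> (restrict_relations \<Gamma> X)"
      using relations_eq_wreath_product[OF E(1,2) \<Gamma> _ \<phi>] closed by simp
  qed (use card_parabolic_class_ge_2[OF E(1,2)] card_transversal_ge_2[OF equiv_E \<Gamma> E(3)] in simp_all)
qed

end

section \<open>Higmanian schemes\<close>

locale higmanian_scheme = sym_scheme X for X :: "('n::finite \<times> 'n) set set" +
  fixes E F S T :: "('n \<times> 'n) set" and f m n k t :: nat
  assumes parabolic_E: "parabolic UNIV X E" and parabolic_F: "parabolic UNIV X F"
    and E_subset_F: "E \<subseteq> F" and F_proper: "F \<noteq> UNIV"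
    and relations_eq: "X = {Id, E - Id, F - E, S, T}" and rank_5: "card X = 5"
    and outside_F: "S \<union> T = - F" and S_neq_T: "S \<noteq> T"
    and indecomposable: "\<not> decomposable UNIV X"
    and valency_E: "valency UNIV E = n" and valency_F: "valency UNIV F = m * n"
    and card_points: "CARD('n) = f * m * n"
    and f_ge_2: "2 \<le> f" and m_ge_2: "2 \<le> m" and n_ge_2: "2 \<le> n"
    and k_eq: "k = (THE k. \<forall>\<alpha>\<in>UNIV. \<forall>\<Delta>\<in>UNIV // F. \<alpha> \<notin> \<Delta> \<longrightarrow> card {\<beta>\<in>\<Delta>. (\<alpha>, \<beta>) \<in> S} = k)"
    and t_eq: "t = intersection_number T S T"
begin

abbreviation "J \<equiv> all_ones :: complex^'n^'n"
abbreviation "A\<^sub>F \<equiv> adjacency_matrix F"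
abbreviation "A\<^sub>S \<equiv> adjacency_matrix S"

lemma basic_relations: "E - Id \<in> X" "F - E \<in> X" "S \<in> X" "T \<in> X"
  using relations_eq by auto

lemma equiv_E: "equiv UNIV E" and equiv_F: "equiv UNIV F"
  using parabolic_E parabolic_F by (auto simp: parabolic_def)

lemma refl_E [simp]: "(\<alpha>, \<alpha>) \<in> E" and refl_F [simp]: "(\<alpha>, \<alpha>) \<in> F"
  using equiv_E equiv_F by (auto simp: equiv_def refl_on_def)

lemma E_imp_F: "(\<alpha>, \<beta>) \<in> E \<Longrightarrow> (\<alpha>, \<beta>) \<in> F"
  using E_subset_F by auto

lemma S_imp_not_F: "(\<alpha>, \<beta>) \<in> S \<Longrightarrow> (\<alpha>, \<beta>) \<notin> F" and T_imp_not_F: "(\<alpha>, \<beta>) \<in> T \<Longrightarrow> (\<alpha>, \<beta>) \<notin> F"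
  using outside_F by blast+

lemma T_imp_not_S: "(\<alpha>, \<beta>) \<in> T \<Longrightarrow> (\<alpha>, \<beta>) \<notin> S"
  using relation_eqI basic_relations S_neq_T by blast

lemma F_eq_left: "(\<alpha>, \<alpha>') \<in> F \<Longrightarrow> (\<alpha>, \<beta>) \<in> F \<longleftrightarrow> (\<alpha>', \<beta>) \<in> F"
  by (simp add: equiv_class_eq_iff[OF equiv_F])

lemma T_eq: "T = UNIV - F - S"
  using outside_F T_imp_not_S by auto

lemma not_block_closed_S: "\<not> block_closed E S"
proof
  assume closed_S: "block_closed E S"
  have "sym E"
    using equiv_E by (simp add: equiv_def)
  note diff_closed = block_closed_diff[OF this]
  have closed_E: "block_closed E E" and closed_F: "block_closed E F"
    using block_closed_equiv equiv_E equiv_F E_subset_F by blast+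
  have "block_closed E UNIV"
    by (simp add: block_closed_def)
  then have closed_T: "block_closed E T"
    unfolding T_eq by (intro diff_closed closed_F closed_S)
  have "block_closed E R" if "R \<in> X" "\<not> R \<subseteq> E" for R
  proof -
    have "Id \<subseteq> E"
      by auto
    then have "R \<in> {F - E, S, T}"
      using that relations_eq by auto
    then show ?thesis
      using closed_S closed_T diff_closed[OF closed_F closed_E] by auto
  qed
  then have "decomposable UNIV X"
    using decomposable_if_block_closed[OF parabolic_E basic_relations(1)] E_subset_F F_proper
    by blast
  then show False
    using indecomposable by simp
qed

lemma block_constant_outside_F:
  assumes A: "A \<in> block_algebra X E" and "(\<alpha>, \<beta>) \<notin> F" "(\<alpha>', \<beta>') \<notin> F"
  shows "A $ \<alpha> $ \<beta> = A $ \<alpha>' $ \<beta>'"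
proof -
  have alg: "A \<in> adjacency_algebra X"
    using A by (simp add: block_algebra_def)
  obtain \<gamma> \<gamma>' \<delta> \<delta>' where mixed: "(\<gamma>, \<gamma>') \<in> E" "(\<delta>, \<delta>') \<in> E" "(\<gamma>, \<delta>) \<in> S" "(\<gamma>', \<delta>') \<notin> S"
    using not_block_closed_S unfolding block_closed_def by blast
  have "(\<gamma>', \<delta>') \<notin> F"
    using mixed S_imp_not_F[OF mixed(3)] E_imp_F by (auto simp: equiv_class_eq_iff[OF equiv_F])
  then have "(\<gamma>', \<delta>') \<in> T"
    using mixed(4) by (simp add: T_eq)
  have "A $ \<gamma> $ \<delta> = A $ \<gamma>' $ \<delta>'"
    using A mixed(1,2) by (simp add: block_algebra_def constant_on_blocks_iff[OF equiv_E])
  moreover have "A $ \<epsilon> $ \<zeta> = A $ \<gamma> $ \<delta> \<or> A $ \<epsilon> $ \<zeta> = A $ \<gamma>' $ \<delta>'" if "(\<epsilon>, \<zeta>) \<notin> F" for \<epsilon> \<zeta>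
  proof (cases "(\<epsilon>, \<zeta>) \<in> S")
    case True
    then show ?thesis
      using algebra_constant[OF alg basic_relations(3) True mixed(3)] by simp
  next
    case False
    then have "(\<epsilon>, \<zeta>) \<in> T"
      using that by (simp add: T_eq)
    then show ?thesis
      using algebra_constant[OF alg basic_relations(4) _ \<open>(\<gamma>', \<delta>') \<in> T\<close>] by simp
  qed
  ultimately show ?thesis
    using assms(2,3) by metis
qed

lemma mat_1_in_algebra: "mat 1 \<in> adjacency_algebra X"
  using averaging_in_algebra[OF parabolic_Id] by (simp add: averaging_matrix_Id)

lemma A\<^sub>F_in_algebra: "A\<^sub>F \<in> adjacency_algebra X" and A\<^sub>S_in_algebra: "A\<^sub>S \<in> adjacency_algebra X"
  by (intro parabolic_in_algebra parabolic_F adjacency_in_algebra basic_relations)+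

lemma averaging_EF_in_algebra:
  "averaging_matrix E \<in> adjacency_algebra X" "averaging_matrix F \<in> adjacency_algebra X"
  "averaging_matrix UNIV \<in> adjacency_algebra X"
  by (intro averaging_in_algebra parabolic_E parabolic_F parabolic_UNIV)+

lemma averaging_products:
  "averaging_matrix E ** averaging_matrix E = averaging_matrix E"
  "averaging_matrix E ** averaging_matrix F = averaging_matrix F"
  "averaging_matrix F ** averaging_matrix E = averaging_matrix F"
  "averaging_matrix F ** averaging_matrix F = averaging_matrix F"
  "averaging_matrix E ** averaging_matrix UNIV = averaging_matrix UNIV"
  "averaging_matrix UNIV ** averaging_matrix E = averaging_matrix UNIV"
  "averaging_matrix F ** averaging_matrix UNIV = averaging_matrix UNIV"
  "averaging_matrix UNIV ** averaging_matrix F = averaging_matrix UNIV"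
  "averaging_matrix UNIV ** averaging_matrix UNIV = (averaging_matrix UNIV :: complex^'n^'n)"
  by (intro averaging_fine_mult_coarse averaging_coarse_mult_fine parabolic_E parabolic_F
      parabolic_UNIV E_subset_F order_refl subset_UNIV)+

lemma J_eq: "J = mat_scale (of_nat f * of_nat m * of_nat n) (averaging_matrix UNIV)"
  using f_ge_2 m_ge_2 n_ge_2 by (simp add: averaging_matrix_UNIV card_points)

lemma A\<^sub>F_eq: "A\<^sub>F = mat_scale (of_nat m * of_nat n) (averaging_matrix F)"
  by (simp add: adjacency_eq_averaging[OF parabolic_F] valency_F)

lemma averaging_outside_F:
  "averaging_matrix E ** (J - A\<^sub>F) = J - A\<^sub>F" "averaging_matrix F ** (J - A\<^sub>F) = J - A\<^sub>F"
  by (simp_all add: J_eq A\<^sub>F_eq matrix_diff_ldistrib averaging_products)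

lemma averaging_mult_S:
  obtains c where "averaging_matrix E ** A\<^sub>S = mat_scale c (J - A\<^sub>F)"
    "averaging_matrix F ** A\<^sub>S = mat_scale c (J - A\<^sub>F)"
proof -
  let ?A = "averaging_matrix E ** A\<^sub>S"
  have block: "?A \<in> block_algebra X E"
    unfolding block_algebra_eq_averaging[OF parabolic_E]
    by (simp add: matrix_mul_assoc averaging_products mult_in_algebra averaging_EF_in_algebra
        A\<^sub>S_in_algebra)
  have inside: "?A $ \<alpha> $ \<beta> = 0" if "(\<alpha>, \<beta>) \<in> F" for \<alpha> \<beta>
  proof -
    have "(\<gamma>, \<beta>) \<notin> S" if "\<gamma> \<in> E `` {\<alpha>}" for \<gamma>
      using that \<open>(\<alpha>, \<beta>) \<in> F\<close> F_eq_left E_imp_F S_imp_not_F by blast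
    then show ?thesis
      by (auto simp: averaging_mult_entry intro!: sum.neutral)
  qed
  obtain \<alpha>\<^sub>0 \<beta>\<^sub>0 where outside: "(\<alpha>\<^sub>0, \<beta>\<^sub>0) \<notin> F"
    using F_proper by auto
  define c where "c = ?A $ \<alpha>\<^sub>0 $ \<beta>\<^sub>0"
  have "?A $ \<alpha> $ \<beta> = mat_scale c (J - A\<^sub>F) $ \<alpha> $ \<beta>" for \<alpha> \<beta>
    using inside block_constant_outside_F[OF block _ outside, of \<alpha> \<beta>] by (auto simp: c_def)
  then have E: "?A = mat_scale c (J - A\<^sub>F)"
    by (simp add: vec_eq_iff)
  have "averaging_matrix F ** A\<^sub>S = averaging_matrix F ** ?A"
    by (simp add: matrix_mul_assoc averaging_products)
  then have "averaging_matrix F ** A\<^sub>S = mat_scale c (J - A\<^sub>F)"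
    by (simp add: E averaging_outside_F)
  with E show thesis
    by (rule that)
qed

lemma of_nat_card_S_class:
  "of_nat (card {\<beta>\<in>F `` {\<delta>}. (\<alpha>, \<beta>) \<in> S}) = (A\<^sub>F ** A\<^sub>S) $ \<delta> $ \<alpha>"
proof -
  have "{\<beta>\<in>F `` {\<delta>}. (\<alpha>, \<beta>) \<in> S} = {\<gamma>. (\<delta>, \<gamma>) \<in> F \<and> (\<gamma>, \<alpha>) \<in> S}"
    using relation_symmetric[OF basic_relations(3)] by auto
  then show ?thesis
    by (simp add: adjacency_mult_adjacency_entry)
qed

lemma card_S_class: "\<Delta> \<in> UNIV // F \<Longrightarrow> \<alpha> \<notin> \<Delta> \<Longrightarrow> card {\<beta>\<in>\<Delta>. (\<alpha>, \<beta>) \<in> S} = k"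
  and averaging_E_mult_S: "averaging_matrix E ** A\<^sub>S =
      mat_scale (of_nat k / (of_nat m * of_nat n)) (J - A\<^sub>F)"
  and averaging_F_mult_S: "averaging_matrix F ** A\<^sub>S =
      mat_scale (of_nat k / (of_nat m * of_nat n)) (J - A\<^sub>F)"
proof -
  obtain c where averaging_S: "averaging_matrix E ** A\<^sub>S = mat_scale c (J - A\<^sub>F)"
    "averaging_matrix F ** A\<^sub>S = mat_scale c (J - A\<^sub>F)"
    using averaging_mult_S .
  have count: "of_nat (card {\<beta>\<in>\<Delta>. (\<alpha>, \<beta>) \<in> S}) = of_nat m * of_nat n * c"
    if "\<Delta> \<in> UNIV // F" "\<alpha> \<notin> \<Delta>" for \<alpha> \<Delta>
  proof -
    obtain \<delta> where \<delta>: "\<Delta> = F `` {\<delta>}"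
      using \<open>\<Delta> \<in> UNIV // F\<close> by (auto simp: quotient_def)
    then show ?thesis
      using that(2) unfolding \<delta> of_nat_card_S_class by (subst A\<^sub>F_eq) (simp add: averaging_S(2))
  qed
  obtain \<alpha>\<^sub>0 \<delta> where "(\<delta>, \<alpha>\<^sub>0) \<notin> F"
    using F_proper by auto
  then have exists: "F `` {\<delta>} \<in> UNIV // F" "\<alpha>\<^sub>0 \<notin> F `` {\<delta>}"
    by (auto simp: quotientI)
  define K where "K = card {\<beta>\<in>F `` {\<delta>}. (\<alpha>\<^sub>0, \<beta>) \<in> S}"
  have count_eq: "card {\<beta>\<in>\<Delta>. (\<alpha>, \<beta>) \<in> S} = K" if "\<Delta> \<in> UNIV // F" "\<alpha> \<notin> \<Delta>" for \<alpha> \<Delta>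
    using count[OF that, folded count[OF exists]] unfolding K_def by (simp only: of_nat_eq_iff)
  have "k = K"
    unfolding k_eq
  proof (rule the_equality)
    fix k assume "\<forall>\<alpha>\<in>UNIV. \<forall>\<Delta>\<in>UNIV // F. \<alpha> \<notin> \<Delta> \<longrightarrow> card {\<beta>\<in>\<Delta>. (\<alpha>, \<beta>) \<in> S} = k"
    then show "k = K"
      using exists K_def by blast
  qed (use count_eq in blast)
  then show "card {\<beta>\<in>\<Delta>. (\<alpha>, \<beta>) \<in> S} = k" if "\<Delta> \<in> UNIV // F" "\<alpha> \<notin> \<Delta>" for \<alpha> \<Delta>
    using count_eq[OF that] by simp
  have "of_nat k = of_nat m * of_nat n * c"
    using count[OF exists] \<open>k = K\<close> by (simp add: K_def)
  then have "c = of_nat k / (of_nat m * of_nat n)"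
    using m_ge_2 n_ge_2 by simp
  then show "averaging_matrix E ** A\<^sub>S = mat_scale (of_nat k / (of_nat m * of_nat n)) (J - A\<^sub>F)"
    "averaging_matrix F ** A\<^sub>S = mat_scale (of_nat k / (of_nat m * of_nat n)) (J - A\<^sub>F)"
    using averaging_S by simp_all
qed

lemma F_class_disjoint: "(\<alpha>, \<beta>) \<notin> F \<Longrightarrow> F `` {\<beta>} \<in> UNIV // F" "(\<alpha>, \<beta>) \<notin> F \<Longrightarrow> \<alpha> \<notin> F `` {\<beta>}"
  by (auto simp: quotientI equiv_class_eq_iff[OF equiv_F])

lemma k_pos: "0 < k"
proof -
  obtain \<alpha> \<beta> where S: "(\<alpha>, \<beta>) \<in> S"
    using relation_nonempty[OF basic_relations(3)] by auto
  then have "{\<gamma>\<in>F `` {\<beta>}. (\<alpha>, \<gamma>) \<in> S} \<noteq> {}"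
    by force
  then show ?thesis
    using card_S_class[OF F_class_disjoint[OF S_imp_not_F[OF S]]] by (metis card_gt_0_iff finite)
qed

lemma k_less: "k < m * n"
proof -
  obtain \<alpha> \<beta> where T: "(\<alpha>, \<beta>) \<in> T"
    using relation_nonempty[OF basic_relations(4)] by auto
  have "\<beta> \<in> F `` {\<beta>} - {\<gamma>\<in>F `` {\<beta>}. (\<alpha>, \<gamma>) \<in> S}"
    using T_imp_not_S[OF T] by simp
  then have "{\<gamma>\<in>F `` {\<beta>}. (\<alpha>, \<gamma>) \<in> S} \<subset> F `` {\<beta>}"
    by blast
  then have "card {\<gamma>\<in>F `` {\<beta>}. (\<alpha>, \<gamma>) \<in> S} < card (F `` {\<beta>})"
    by (rule psubset_card_mono[OF finite])
  also have "card (F `` {\<beta>}) = m * n"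
    by (simp only: card_parabolic_class[OF parabolic_F] valency_F)
  finally show ?thesis
    by (simp only: card_S_class[OF F_class_disjoint[OF T_imp_not_F[OF T]]])
qed

lemma parameters_neq [simp]: "f \<noteq> 0" "m \<noteq> 0" "n \<noteq> 0" "k \<noteq> 0" "f \<noteq> Suc 0" "m \<noteq> Suc 0" "n \<noteq> Suc 0"
  using f_ge_2 m_ge_2 n_ge_2 k_pos by auto

definition "N = mat 1 - averaging_matrix E"
definition "G = A\<^sub>S - mat_scale (of_nat k / (of_nat m * of_nat n)) (J - A\<^sub>F)"

lemma N_in_algebra: "N \<in> adjacency_algebra X" and G_in_algebra: "G \<in> adjacency_algebra X"
  unfolding N_def G_def
  by (intro algebra_diff algebra_scale mat_1_in_algebra averaging_EF_in_algebra A\<^sub>S_in_algebra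
      A\<^sub>F_in_algebra all_ones_in_algebra)+

lemma averaging_E_mult_N: "averaging_matrix E ** N = 0"
  by (simp add: N_def matrix_diff_ldistrib averaging_products)

lemma averaging_E_mult_G: "averaging_matrix E ** G = 0"
  by (simp add: G_def matrix_diff_ldistrib[of _ A\<^sub>S] averaging_E_mult_S averaging_outside_F)

lemma N_mult_N: "N ** N = N" and N_mult_G: "N ** G = G"
  using averaging_E_mult_N averaging_E_mult_G by (simp_all add: N_def matrix_diff_rdistrib)

lemma G_mult_N: "G ** N = G"
  using algebra_commute[OF G_in_algebra N_in_algebra] N_mult_G by simp

lemma N_entry:
  "N $ \<alpha> $ \<beta> = (if \<alpha> = \<beta> then 1 - 1 / of_nat n else if (\<alpha>, \<beta>) \<in> E then - 1 / of_nat n else 0)"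
  by (auto simp: N_def averaging_matrix_def valency_E mat_def)

lemma G_entry: "G $ \<alpha> $ \<beta> = (if (\<alpha>, \<beta>) \<in> F then 0
    else if (\<alpha>, \<beta>) \<in> S then 1 - of_nat k / (of_nat m * of_nat n)
    else - of_nat k / (of_nat m * of_nat n))"
  using S_imp_not_F by (auto simp: G_def)

lemma N_mult_eq: "N ** A = A - averaging_matrix E ** A"
  for A :: "complex^'n^'n"
  by (simp add: N_def matrix_diff_rdistrib)

lemma N_mult_in_span_N_G:
  assumes "A \<in> adjacency_algebra X"
  shows "N ** A \<in> cmat.span {N, G}"
proof -
  define V where "V = {A. N ** A \<in> cmat.span {N, G}}"
  have V_diff: "A - B \<in> V" if "A \<in> V" "B \<in> V" for A B
    using that by (simp add: V_def matrix_diff_ldistrib cmat.span_diff)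
  have V_fixed: "A \<in> V" if "averaging_matrix E ** A = A" for A
    using that by (simp add: V_def N_mult_eq cmat.span_zero)
  have "cmat.subspace V"
    by (rule cmat.subspaceI)
      (simp_all add: V_def cmat.span_zero matrix_add_ldistrib cmat.span_add cmat.span_scale)
  have one_V: "mat 1 \<in> V"
    by (simp add: V_def cmat.span_base)
  have "N ** A\<^sub>S = G"
    by (simp add: N_mult_eq G_def averaging_E_mult_S)
  then have S_V: "A\<^sub>S \<in> V"
    by (simp add: V_def cmat.span_base)
  have J_V: "J \<in> V" and E_V: "adjacency_matrix E \<in> V" and F_V: "A\<^sub>F \<in> V"
    by (intro V_fixed; simp add: J_eq adjacency_eq_averaging parabolic_E parabolic_F
        averaging_products)+
  have "adjacency_matrix Id = (mat 1 :: complex^'n^'n)"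
    "adjacency_matrix (E - Id) = adjacency_matrix E - mat 1"
    "adjacency_matrix (F - E) = A\<^sub>F - adjacency_matrix E" "adjacency_matrix T = J - A\<^sub>F - A\<^sub>S"
    using E_imp_F S_imp_not_F by (auto simp: vec_eq_iff mat_def T_eq)
  then have "adjacency_matrix ` X \<subseteq> V"
    using one_V S_V J_V E_V F_V by (simp add: relations_eq V_diff)
  then show ?thesis
    using assms cmat.span_minimal[OF _ \<open>cmat.subspace V\<close>]
    unfolding adjacency_algebra_def V_def by blast
qed

lemma J_mult_S: "J ** A\<^sub>S = mat_scale (of_nat k * (of_nat f - 1)) J"
proof -
  have "J ** A\<^sub>S = (J ** averaging_matrix F) ** A\<^sub>S"
    unfolding J_eq by (simp add: averaging_products)
  also have "\<dots> = mat_scale (of_nat k / (of_nat m * of_nat n)) (J ** (J - A\<^sub>F))"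
    by (simp add: averaging_F_mult_S flip: matrix_mul_assoc)
  also have "J ** (J - A\<^sub>F) = mat_scale (of_nat m * of_nat n * (of_nat f - 1)) J"
    unfolding J_eq A\<^sub>F_eq
    by (simp add: matrix_diff_ldistrib averaging_products vec_eq_iff algebra_simps)
  finally show ?thesis
    by (simp add: field_simps)
qed

end

section \<open>The primitive idempotents\<close>

context higmanian_scheme
begin

definition "eigenvalue_sum =
    real m * real n * real t / real k - (real f - 2) * (real m * real n - real k)"
definition "eigenvalue_scale = sqrt (real k * (real m * real n - real k) / (real m * (real n - 1)))"

lemma eigenvalue_scale_square:
  "eigenvalue_scale\<^sup>2 = real k * (real m * real n - real k) / (real m * (real n - 1))"
  and eigenvalue_scale_pos: "0 < eigenvalue_scale"
proof -
  have "real k < real m * real n"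
    using k_less by (metis of_nat_less_iff of_nat_mult)
  then have "0 < real k * (real m * real n - real k) / (real m * (real n - 1))"
    using k_pos n_ge_2 m_ge_2 by simp
  then show "eigenvalue_scale\<^sup>2 = real k * (real m * real n - real k) / (real m * (real n - 1))"
    "0 < eigenvalue_scale"
    by (simp_all add: eigenvalue_scale_def)
qed

lemma averaging_F_mult_N: "averaging_matrix F ** N = 0"
  and averaging_UNIV_mult_N: "averaging_matrix UNIV ** N = 0"
  by (simp_all add: N_def matrix_diff_ldistrib averaging_products)

lemma averaging_F_mult_G: "averaging_matrix F ** G = 0"
  and averaging_UNIV_mult_G: "averaging_matrix UNIV ** G = 0"
proof -
  have "averaging_matrix F ** (averaging_matrix E ** G) = 0"
    "averaging_matrix UNIV ** (averaging_matrix E ** G) = 0"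
    by (simp_all add: averaging_E_mult_G)
  then show "averaging_matrix F ** G = 0" "averaging_matrix UNIV ** G = 0"
    by (simp_all add: matrix_mul_assoc averaging_products)
qed

lemma G_mult_G_eq: "G ** G = G ** A\<^sub>S"
proof -
  have "G ** (J - A\<^sub>F) = (J - A\<^sub>F) ** G"
    by (intro algebra_commute G_in_algebra algebra_diff all_ones_in_algebra A\<^sub>F_in_algebra)
  also have "\<dots> = 0"
    by (simp add: J_eq A\<^sub>F_eq matrix_diff_rdistrib averaging_F_mult_G averaging_UNIV_mult_G)
  finally show ?thesis
    by (subst (2) G_def) (simp add: matrix_diff_ldistrib[of _ A\<^sub>S])
qed

lemma G_mult_G_diagonal:
  "(G ** G) $ \<alpha> $ \<alpha> = (1 - of_nat k / (of_nat m * of_nat n)) * (of_nat k * (of_nat f - 1))"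
proof -
  have "(G ** G) $ \<alpha> $ \<alpha> = (\<Sum>\<gamma>\<in>UNIV. G $ \<alpha> $ \<gamma> * A\<^sub>S $ \<gamma> $ \<alpha>)"
    unfolding G_mult_G_eq by (simp add: matrix_matrix_mult_def)
  also have "\<dots> = (\<Sum>\<gamma>\<in>UNIV. (1 - of_nat k / (of_nat m * of_nat n)) * (J $ \<alpha> $ \<gamma> * A\<^sub>S $ \<gamma> $ \<alpha>))"
    using relation_symmetric[OF basic_relations(3)] S_imp_not_F
    by (intro sum.cong) (auto simp: G_entry)
  also have "\<dots> = (1 - of_nat k / (of_nat m * of_nat n)) * (J ** A\<^sub>S) $ \<alpha> $ \<alpha>"
    unfolding sum_distrib_left[symmetric] by (simp add: matrix_matrix_mult_def)
  finally show ?thesis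
    by (simp add: J_mult_S)
qed

lemma G_mult_G_T:
  assumes T: "(\<alpha>, \<beta>) \<in> T"
  shows "(G ** G) $ \<alpha> $ \<beta> = - (of_nat k / (of_nat m * of_nat n)) * of_real eigenvalue_sum"
proof -
  define q :: complex where "q = of_nat k / (of_nat m * of_nat n)"
  have A\<^sub>T: "adjacency_matrix T = mat_scale (1 - q) (J - A\<^sub>F) - G"
    using S_imp_not_F by (auto simp: vec_eq_iff G_entry q_def T_eq)
  have "A\<^sub>F ** A\<^sub>S = mat_scale (of_nat k) (J - A\<^sub>F)"
    by (subst A\<^sub>F_eq) (simp add: averaging_F_mult_S)
  then have "adjacency_matrix T ** A\<^sub>S =
      mat_scale (1 - q) (mat_scale (of_nat k * (of_nat f - 1)) J - mat_scale (of_nat k) (J - A\<^sub>F))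
      - G ** G"
    by (simp add: A\<^sub>T matrix_diff_rdistrib J_mult_S G_mult_G_eq)
  moreover have "of_nat t = (adjacency_matrix T ** A\<^sub>S) $ \<alpha> $ \<beta>"
    unfolding adjacency_mult_adjacency_entry t_eq
    using intersection_number_eq[OF basic_relations(4,3,4) T] by simp
  ultimately have t: "of_nat t =
      (1 - q) * (of_nat k * (of_nat f - 1) - of_nat k) - (G ** G) $ \<alpha> $ \<beta>"
    using T_imp_not_F[OF T] by simp
  then have "(G ** G) $ \<alpha> $ \<beta> = (1 - q) * (of_nat k * (of_nat f - 1) - of_nat k) - of_nat t"
    by (simp only: t diff_diff_eq2 add_diff_cancel_left')
  also have "\<dots> = - q * of_real eigenvalue_sum"
    by (simp add: eigenvalue_sum_def q_def field_simps)
  finally show ?thesis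
    by (simp add: q_def)
qed

lemma G_mult_G:
  "G ** G = mat_scale (of_real eigenvalue_sum) G +
    mat_scale (of_real ((real f - 1) * eigenvalue_scale\<^sup>2)) N"
proof -
  have "G ** G \<in> cmat.span {N, G}"
    using N_mult_in_span_N_G[OF mult_in_algebra[OF G_in_algebra G_in_algebra]]
    by (simp add: matrix_mul_assoc N_mult_G)
  then obtain p where "G ** G - mat_scale p N \<in> cmat.span {G}"
    unfolding cmat.span_insert by blast
  then obtain q where "G ** G - mat_scale p N = mat_scale q G"
    by (auto simp: cmat.span_singleton)
  then have G_square: "G ** G = mat_scale q G + mat_scale p N"
    by (simp add: diff_eq_eq)
  obtain \<alpha> \<beta> where T: "(\<alpha>, \<beta>) \<in> T"
    using relation_nonempty[OF basic_relations(4)] by auto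
  have "\<alpha> \<noteq> \<beta>" "(\<alpha>, \<beta>) \<notin> E"
    using T_imp_not_F[OF T] E_imp_F by auto
  then have "q = of_real eigenvalue_sum"
    using G_mult_G_T[OF T] T_imp_not_F[OF T] T_imp_not_S[OF T]
    by (simp add: G_square G_entry N_entry)
  moreover have "p * (1 - 1 / of_nat n) =
      of_real ((real f - 1) * eigenvalue_scale\<^sup>2) * (1 - 1 / of_nat n)"
    using G_mult_G_diagonal[of undefined]
    by (simp add: G_square G_entry N_entry eigenvalue_scale_square) (simp add: field_simps)
  then have "p = of_real ((real f - 1) * eigenvalue_scale\<^sup>2)"
    by (subst (asm) mult_cancel_right) simp
  ultimately show ?thesis
    by (simp add: G_square)
qed

definition "eigenvalues \<theta> \<tau> \<longleftrightarrow>
  \<theta> + \<tau> = eigenvalue_sum \<and> \<theta> * \<tau> = - ((real f - 1) * eigenvalue_scale\<^sup>2) \<and> \<theta> \<noteq> \<tau>"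

lemma eigenvalues_commute: "eigenvalues \<theta> \<tau> \<Longrightarrow> eigenvalues \<tau> \<theta>"
  by (simp add: eigenvalues_def algebra_simps)

lemma eigenvalues_nonzero:
  assumes "eigenvalues \<theta> \<tau>"
  shows "\<theta> \<noteq> 0" "\<tau> \<noteq> 0"
  using assms f_ge_2 eigenvalue_scale_pos by (auto simp: eigenvalues_def)

lemma eigenvalues_exist:
  obtains \<theta> \<tau> where "eigenvalues \<theta> \<tau>"
proof
  let ?p = "(real f - 1) * eigenvalue_scale\<^sup>2"
  define D where "D = sqrt (eigenvalue_sum\<^sup>2 + 4 * ?p)"
  have "0 < ?p"
    using f_ge_2 eigenvalue_scale_pos by simp
  then have "D\<^sup>2 = eigenvalue_sum\<^sup>2 + 4 * ?p" "D > 0"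
    by (simp_all add: D_def add_nonneg_pos)
  then show "eigenvalues ((eigenvalue_sum + D) / 2) ((eigenvalue_sum - D) / 2)"
    by (simp add: eigenvalues_def field_simps power2_eq_square)
qed

definition "e\<^sub>0 = averaging_matrix (UNIV :: ('n \<times> 'n) set)"
definition "e\<^sub>F = averaging_matrix F - averaging_matrix UNIV"
definition "e\<^sub>E = averaging_matrix E - averaging_matrix F"
definition "P \<theta> \<tau> = spectral_projection N G (of_real \<theta>) (of_real \<tau>)"
definition "idempotents \<theta> \<tau> = [e\<^sub>0, P \<theta> \<tau>, e\<^sub>E, P \<tau> \<theta>, e\<^sub>F]"

lemma idempotents_in_algebra: "set (idempotents \<theta> \<tau>) \<subseteq> adjacency_algebra X"
  unfolding idempotents_def e\<^sub>0_def e\<^sub>F_def e\<^sub>E_def P_def spectral_projection_def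
  by (simp add: averaging_EF_in_algebra algebra_diff algebra_scale G_in_algebra N_in_algebra)

lemma averaging_mult_P:
  "averaging_matrix E ** P \<theta> \<tau> = 0" "averaging_matrix F ** P \<theta> \<tau> = 0"
  "averaging_matrix UNIV ** P \<theta> \<tau> = 0"
  by (simp_all add: P_def spectral_projection_def matrix_diff_ldistrib
      averaging_E_mult_N averaging_E_mult_G averaging_F_mult_N averaging_F_mult_G
      averaging_UNIV_mult_N averaging_UNIV_mult_G)

lemma P_products:
  assumes "eigenvalues \<theta> \<tau>"
  shows "P \<theta> \<tau> ** P \<theta> \<tau> = P \<theta> \<tau>" "P \<theta> \<tau> ** P \<tau> \<theta> = 0"
proof -
  have "G ** G = mat_scale (of_real \<theta> + of_real \<tau>) G - mat_scale (of_real \<theta> * of_real \<tau>) N"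
  proof -
    have "eigenvalue_sum = \<theta> + \<tau>" "(real f - 1) * eigenvalue_scale\<^sup>2 = - (\<theta> * \<tau>)"
      using assms by (simp_all add: eigenvalues_def)
    then show ?thesis
      by (simp only: G_mult_G) simp
  qed
  then show "P \<theta> \<tau> ** P \<theta> \<tau> = P \<theta> \<tau>" "P \<theta> \<tau> ** P \<tau> \<theta> = 0"
    unfolding P_def using assms
    by (intro spectral_projections N_mult_N N_mult_G G_mult_N; simp add: eigenvalues_def)+
qed

lemma P_mult_averaging:
  "P \<theta> \<tau> ** averaging_matrix E = 0" "P \<theta> \<tau> ** averaging_matrix F = 0"
  "P \<theta> \<tau> ** averaging_matrix UNIV = 0"
proof -
  have "P \<theta> \<tau> \<in> adjacency_algebra X"
    using idempotents_in_algebra by (simp add: idempotents_def)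
  then show "P \<theta> \<tau> ** averaging_matrix E = 0" "P \<theta> \<tau> ** averaging_matrix F = 0"
    "P \<theta> \<tau> ** averaging_matrix UNIV = 0"
    using algebra_commute[of "P \<theta> \<tau>"] averaging_EF_in_algebra averaging_mult_P by simp_all
qed

lemma idempotents_mult_self:
  assumes "eigenvalues \<theta> \<tau>" "M \<in> set (idempotents \<theta> \<tau>)"
  shows "M ** M = M"
proof -
  have "e\<^sub>0 ** e\<^sub>0 = e\<^sub>0" "e\<^sub>F ** e\<^sub>F = e\<^sub>F" "e\<^sub>E ** e\<^sub>E = e\<^sub>E"
    by (simp_all add: e\<^sub>0_def e\<^sub>F_def e\<^sub>E_def matrix_distribs averaging_products)
  then show ?thesis
    using assms P_products(1) eigenvalues_commute by (auto simp: idempotents_def)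
qed

lemma idempotents_pairwise_orthogonal:
  assumes "eigenvalues \<theta> \<tau>"
  shows "sorted_wrt (\<lambda>M M'. M ** M' = 0 \<and> M' ** M = 0) (idempotents \<theta> \<tau>)"
proof -
  have "e\<^sub>0 ** e\<^sub>F = 0" "e\<^sub>F ** e\<^sub>0 = 0" "e\<^sub>0 ** e\<^sub>E = 0" "e\<^sub>E ** e\<^sub>0 = 0" "e\<^sub>F ** e\<^sub>E = 0"
    "e\<^sub>E ** e\<^sub>F = 0"
    by (simp_all add: e\<^sub>0_def e\<^sub>F_def e\<^sub>E_def matrix_distribs averaging_products)
  moreover have "e ** P \<theta> \<tau> = 0" "P \<theta> \<tau> ** e = 0" if "e \<in> {e\<^sub>0, e\<^sub>F, e\<^sub>E}" for e \<theta> \<tau>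
    using that
    by (auto simp: e\<^sub>0_def e\<^sub>F_def e\<^sub>E_def matrix_distribs averaging_mult_P P_mult_averaging)
  ultimately show ?thesis
    using P_products(2)[OF assms] P_products(2)[OF eigenvalues_commute[OF assms]]
    by (simp add: idempotents_def)
qed

lemma card_quotients: "card (UNIV // E) = f * m" "card (UNIV // F) = f"
  "card (UNIV // (UNIV :: ('n \<times> 'n) set)) = 1"
  using card_quotient_parabolic[OF parabolic_E] card_quotient_parabolic[OF parabolic_F]
    card_quotient_parabolic[OF parabolic_UNIV]
  by (simp_all add: valency_E valency_F valency_UNIV card_points)

lemma trace_N: "trace N = of_nat f * of_nat m * (of_nat n - 1)"
  by (simp add: N_def trace_sub trace_averaging[OF parabolic_E] card_quotients trace_I card_points
      algebra_simps)

lemma trace_G: "trace G = 0"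
  by (simp add: trace_def G_entry)

lemma trace_P: "trace (P \<theta> \<tau>) = of_real (- \<tau> * (real f * real m * (real n - 1)) / (\<theta> - \<tau>))"
  by (simp add: P_def spectral_projection_def trace_mat_scale trace_sub trace_N trace_G)

lemma trace_e: "trace e\<^sub>0 = 1" "trace e\<^sub>F = of_nat f - 1" "trace e\<^sub>E = of_nat f * (of_nat m - 1)"
  by (simp_all add: e\<^sub>0_def e\<^sub>F_def e\<^sub>E_def trace_sub trace_averaging parabolic_E parabolic_F
      parabolic_UNIV card_quotients algebra_simps)

lemma zero_notin_idempotents:
  assumes "eigenvalues \<theta> \<tau>"
  shows "0 \<notin> set (idempotents \<theta> \<tau>)"
proof -
  have "trace (P \<theta> \<tau>) \<noteq> 0" "trace (P \<tau> \<theta>) \<noteq> 0"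
    using assms eigenvalues_nonzero[OF assms] n_ge_2
    unfolding trace_P of_real_eq_0_iff by (auto simp: eigenvalues_def)
  moreover have "trace e\<^sub>0 \<noteq> 0" "trace e\<^sub>F \<noteq> 0" "trace e\<^sub>E \<noteq> 0"
    using f_ge_2 m_ge_2 by (simp_all add: trace_e)
  ultimately show ?thesis
    by (auto simp: idempotents_def trace_def)
qed

lemma idempotents_orthogonal: "eigenvalues \<theta> \<tau> \<Longrightarrow> orthogonal_idempotents (set (idempotents \<theta> \<tau>))"
  and distinct_idempotents: "eigenvalues \<theta> \<tau> \<Longrightarrow> distinct (idempotents \<theta> \<tau>)"
  by (intro orthogonal_idempotents_list idempotents_pairwise_orthogonal idempotents_mult_self
      zero_notin_idempotents; assumption)+

lemma adjacency_algebra_eq_span_idempotents: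
  assumes "eigenvalues \<theta> \<tau>"
  shows "adjacency_algebra X = cmat.span (set (idempotents \<theta> \<tau>))"
proof -
  interpret orthogonal_idempotents "set (idempotents \<theta> \<tau>)"
    by (rule idempotents_orthogonal[OF assms])
  have "card (set (idempotents \<theta> \<tau>)) = 5"
    using distinct_card[OF distinct_idempotents[OF assms]] by (simp add: idempotents_def)
  then show ?thesis
    using idempotents_in_algebra rank_5
    by (intro adjacency_algebra_eq_span) (auto intro: card_ge_0_finite)
qed

lemma primitive_idempotents_eq:
  assumes "eigenvalues \<theta> \<tau>"
  shows "primitive_idempotents X = set (idempotents \<theta> \<tau>)"
  using orthogonal_idempotents.primitive_idempotents_eq[OF idempotents_orthogonal[OF assms]
      adjacency_algebra_eq_span_idempotents[OF assms]] .

lemma rank_e: "rank e\<^sub>0 = 1" "rank e\<^sub>F = f - 1"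
proof -
  have "e\<^sub>0 ** e\<^sub>0 = e\<^sub>0" "e\<^sub>F ** e\<^sub>F = e\<^sub>F"
    by (simp_all add: e\<^sub>0_def e\<^sub>F_def matrix_distribs averaging_products)
  then have "of_nat (rank e\<^sub>0) = (of_nat 1 :: complex)"
    "of_nat (rank e\<^sub>F) = (of_nat (f - 1) :: complex)"
    using f_ge_2 by (simp_all add: rank_idempotent_eq_trace trace_e of_nat_diff)
  then show "rank e\<^sub>0 = 1" "rank e\<^sub>F = f - 1"
    by (simp_all only: of_nat_eq_iff)
qed

lemma rank_P:
  assumes "eigenvalues \<theta> \<tau>"
  shows "real (rank (P \<theta> \<tau>)) = - \<tau> * (real f * real m * (real n - 1)) / (\<theta> - \<tau>)"
  using rank_idempotent_eq_trace[OF P_products(1)[OF assms]] trace_P[of \<theta> \<tau>]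
  by (metis of_real_eq_iff of_real_of_nat_eq)

lemma rank_P_ratio_iff:
  assumes "eigenvalues \<theta> \<tau>"
  shows "int (rank (P \<tau> \<theta>)) = (int f - 1) * int (rank (P \<theta> \<tau>)) \<longleftrightarrow> \<theta> = - (real f - 1) * \<tau>"
proof -
  define K where "K = real f * real m * (real n - 1) / (\<theta> - \<tau>)"
  have "K \<noteq> 0"
    using assms f_ge_2 m_ge_2 n_ge_2 by (simp add: K_def eigenvalues_def)
  have "real (rank (P \<theta> \<tau>)) = - \<tau> * K" "real (rank (P \<tau> \<theta>)) = \<theta> * K"
    unfolding rank_P[OF assms] rank_P[OF eigenvalues_commute[OF assms]] K_def
    using assms by (simp_all add: eigenvalues_def divide_simps) (simp add: algebra_simps)
  then have "real_of_int (int (rank (P \<tau> \<theta>))) = real_of_int ((int f - 1) * int (rank (P \<theta> \<tau>))) \<longleftrightarrow>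
      \<theta> * K = (real f - 1) * (- \<tau> * K)"
    by simp
  also have "(real f - 1) * (- \<tau> * K) = (- (real f - 1) * \<tau>) * K"
    by (simp add: algebra_simps)
  also have "\<theta> * K = (- (real f - 1) * \<tau>) * K \<longleftrightarrow> \<theta> = - (real f - 1) * \<tau>"
    unfolding mult_cancel_right using \<open>K \<noteq> 0\<close> by blast
  finally show ?thesis
    by (simp only: of_int_eq_iff)
qed

section \<open>Krein parameters of a Higmanian scheme\<close>

lemma e\<^sub>0_plus_e\<^sub>F: "e\<^sub>0 + e\<^sub>F = averaging_matrix F"
  by (simp add: e\<^sub>0_def e\<^sub>F_def)

lemma linked_e\<^sub>0_e\<^sub>F: "linked F e\<^sub>0 e\<^sub>F"
proof -
  have "averaging_matrix F ** hadamard e\<^sub>0 e\<^sub>F = hadamard e\<^sub>0 (averaging_matrix F ** e\<^sub>F)"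
    by (intro averaging_hadamard parabolic_F) (simp add: e\<^sub>0_def averaging_products)
  also have "averaging_matrix F ** e\<^sub>F = e\<^sub>F"
    by (simp add: e\<^sub>F_def matrix_diff_ldistrib averaging_products)
  also have "hadamard e\<^sub>0 e\<^sub>F = mat_scale (1 / of_nat CARD('n)) e\<^sub>F"
    by (simp add: vec_eq_iff e\<^sub>0_def averaging_matrix_UNIV)
  finally show ?thesis
    using trace_e(2) f_ge_2 by (auto simp: linked_def trace_def)
qed

lemma not_linked_e:
  assumes "e \<in> {e\<^sub>0, e\<^sub>F}" "M \<in> {e\<^sub>E, P \<theta> \<tau>}"
  shows "\<not> linked F e M"
proof -
  have "averaging_matrix F ** hadamard e M = hadamard e (averaging_matrix F ** M)"
    using assms(1)
    by (intro averaging_hadamard parabolic_F)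
      (auto simp: e\<^sub>0_def e\<^sub>F_def matrix_diff_ldistrib averaging_products)
  moreover have "averaging_matrix F ** M = 0"
    using assms(2) by (auto simp: e\<^sub>E_def matrix_diff_ldistrib averaging_products averaging_mult_P)
  ultimately show ?thesis
    by (simp add: linked_def vec_eq_iff)
qed

lemma not_linked_e\<^sub>E_P: "\<not> linked F e\<^sub>E (P \<theta> \<tau>)"
proof -
  have "averaging_matrix E ** hadamard e\<^sub>E (P \<theta> \<tau>) = hadamard e\<^sub>E (averaging_matrix E ** P \<theta> \<tau>)"
    by (intro averaging_hadamard parabolic_E)
      (simp add: e\<^sub>E_def matrix_diff_ldistrib averaging_products)
  then have "\<not> linked E e\<^sub>E (P \<theta> \<tau>)"
    by (simp add: linked_def averaging_mult_P vec_eq_iff)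
  then show ?thesis
    using linked_mono[OF parabolic_E parabolic_F E_subset_F] by blast
qed

text \<open>On \<open>F\<close> the matrix \<open>G\<close> vanishes, so both projections are multiples of \<open>N\<close> there, and \<open>N\<close>
  vanishes outside \<open>F\<close>.\<close>

lemma linked_P_P:
  assumes "eigenvalues \<theta> \<tau>"
  shows "linked F (P \<theta> \<tau>) (P \<tau> \<theta>)"
proof -
  define c :: complex
    where "c = (- of_real \<tau> / (of_real \<theta> - of_real \<tau>)) * (- of_real \<theta> / (of_real \<tau> - of_real \<theta>))"
  have "c \<noteq> 0"
    using assms eigenvalues_nonzero[OF assms] by (simp add: c_def eigenvalues_def)
  fix \<alpha>
  have on_F: "hadamard (P \<theta> \<tau>) (P \<tau> \<theta>) $ \<gamma> $ \<alpha> = c * hadamard N N $ \<gamma> $ \<alpha>" if "\<gamma> \<in> F `` {\<alpha>}" for \<gamma>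
  proof -
    have "(\<gamma>, \<alpha>) \<in> F"
      using that by (simp add: equiv_class_eq_iff[OF equiv_F])
    then show ?thesis
      by (simp add: P_def spectral_projection_def G_entry c_def)
  qed
  have off_F: "hadamard N N $ \<gamma> $ \<alpha> = 0" if "\<gamma> \<notin> F `` {\<alpha>}" for \<gamma>
  proof -
    have "(\<gamma>, \<alpha>) \<notin> F"
      using that by (simp add: equiv_class_eq_iff[OF equiv_F])
    then show ?thesis
      using E_imp_F by (auto simp: N_entry)
  qed
  have "(\<Sum>\<gamma>\<in>F `` {\<alpha>}. hadamard (P \<theta> \<tau>) (P \<tau> \<theta>) $ \<gamma> $ \<alpha>) = c * (\<Sum>\<gamma>\<in>F `` {\<alpha>}. hadamard N N $ \<gamma> $ \<alpha>)"
    unfolding sum_distrib_left by (rule sum.cong) (simp_all only: on_F)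
  also have "(\<Sum>\<gamma>\<in>F `` {\<alpha>}. hadamard N N $ \<gamma> $ \<alpha>) = (\<Sum>\<gamma>\<in>UNIV. hadamard N N $ \<gamma> $ \<alpha>)"
    by (rule sum.mono_neutral_left) (use off_F in auto)
  also have "\<dots> = 1 - 1 / of_nat n"
    unfolding sum_diagonal_hadamard[OF N_in_algebra] by (simp add: N_mult_N N_entry)
  finally have "(averaging_matrix F ** hadamard (P \<theta> \<tau>) (P \<tau> \<theta>)) $ \<alpha> $ \<alpha> \<noteq> 0"
    using \<open>c \<noteq> 0\<close> by (simp only: averaging_mult_entry valency_F) simp
  then show ?thesis
    unfolding linked_def by force
qed

lemma linked_iff:
  assumes "eigenvalues \<theta> \<tau>" "M \<in> set (idempotents \<theta> \<tau>)" "M' \<in> set (idempotents \<theta> \<tau>)"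
  shows "linked F M M' \<longleftrightarrow> M = M' \<or> {M, M'} = {e\<^sub>0, e\<^sub>F} \<or> {M, M'} = {P \<theta> \<tau>, P \<tau> \<theta>}"
proof (cases "M = M'")
  case True
  moreover have "M \<noteq> 0"
    using assms zero_notin_idempotents by metis
  ultimately show ?thesis
    using linked_idempotent_self[OF parabolic_F _ idempotents_mult_self[OF assms(1,2)]] assms(2)
      idempotents_in_algebra
    by blast
next
  case False
  have linked: "linked F (P \<theta> \<tau>) (P \<tau> \<theta>)" "linked F (P \<tau> \<theta>) (P \<theta> \<tau>)" "linked F e\<^sub>0 e\<^sub>F"
    "linked F e\<^sub>F e\<^sub>0"
    using linked_P_P assms(1) eigenvalues_commute linked_e\<^sub>0_e\<^sub>F linked_commute by blast+
  have not_linked: "\<not> linked F e M" "\<not> linked F M e"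
    if "e \<in> {e\<^sub>0, e\<^sub>F}" "M \<in> {e\<^sub>E, P \<theta> \<tau>}" for e M \<theta> \<tau>
    using not_linked_e[OF that] linked_commute by blast+
  have not_linked_E: "\<not> linked F e\<^sub>E (P \<theta> \<tau>)" "\<not> linked F (P \<theta> \<tau>) e\<^sub>E" for \<theta> \<tau>
    using not_linked_e\<^sub>E_P linked_commute by blast+
  from assms(2,3) False distinct_idempotents[OF assms(1)] show ?thesis
    by (auto simp: idempotents_def doubleton_eq_iff linked not_linked not_linked_E)
qed

end

locale ordered_higmanian_scheme = higmanian_scheme X E F S T f m n k t
  for X :: "('n::finite \<times> 'n) set set" and E F S T f m n k t +
  fixes \<theta> \<tau> :: real and Es :: "nat \<Rightarrow> complex^'n^'n"
  assumes eigenvalues: "eigenvalues \<theta> \<tau>"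
    and ordering: "bij_betw Es {..4} (set (idempotents \<theta> \<tau>))"
    and Es_0: "Es 0 = e\<^sub>0" and Es_4: "Es 4 = e\<^sub>F"
begin

sublocale enumerated: enumerated_idempotents "set (idempotents \<theta> \<tau>)" 4 Es
  by (intro enumerated_idempotents.intro enumerated_idempotents_axioms.intro
      idempotents_orthogonal[OF eigenvalues] ordering)

lemma span_Es_0_4: "cmat.span (Es ` {0, 4}) = block_algebra X F"
proof -
  have "e\<^sub>0 \<noteq> e\<^sub>F"
    using enumerated.eq_iff[of 0 4] by (simp add: Es_0 Es_4)
  then have "\<Sum>{e\<^sub>0, e\<^sub>F} = averaging_matrix F"
    by (simp add: e\<^sub>0_plus_e\<^sub>F)
  then show ?thesis
    using enumerated.span_eq_fixed[of "{e\<^sub>0, e\<^sub>F}"]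
    by (simp add: idempotents_def Es_0 Es_4 block_algebra_eq_averaging[OF parabolic_F]
        adjacency_algebra_eq_span_idempotents[OF eigenvalues])
qed

lemma index_parabolic_0_4: "index_parabolic X Es {0, 4} = F"
  by (rule index_parabolic_eq[OF parabolic_F span_Es_0_4])

lemma index_sets_0_4: "{0, 4} \<in> index_sets X 4 Es"
proof -
  have "set (idempotents \<theta> \<tau>) \<subseteq> cmat.span (set (idempotents \<theta> \<tau>))"
    by (rule cmat.span_superset)
  then have in_algebra: "e\<^sub>E \<in> adjacency_algebra X"
    unfolding adjacency_algebra_eq_span_idempotents[OF eigenvalues] by (simp add: idempotents_def)
  have J: "J = mat_scale (of_nat CARD('n)) e\<^sub>0"
    by (simp add: e\<^sub>0_def averaging_matrix_UNIV)
  have "J \<in> cmat.span {e\<^sub>0}"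
    by (subst J) (intro cmat.span_scale cmat.span_base, simp)
  then have "cmat.span {J} \<subseteq> cmat.span {e\<^sub>0}"
    by (intro cmat.span_minimal cmat.subspace_span) simp
  moreover have "e\<^sub>F \<notin> cmat.span {e\<^sub>0}" "e\<^sub>E \<notin> cmat.span {e\<^sub>0, e\<^sub>F}"
    using distinct_idempotents[OF eigenvalues]
    by (auto simp: idempotents_def enumerated.in_span_iff)
  moreover have "e\<^sub>F \<in> cmat.span {e\<^sub>0, e\<^sub>F}"
    by (simp add: cmat.span_base)
  ultimately have "cmat.span {e\<^sub>0, e\<^sub>F} \<noteq> cmat.span {all_ones}"
    "cmat.span {e\<^sub>0, e\<^sub>F} \<noteq> adjacency_algebra X"
    using in_algebra by blast+
  moreover have "hadamard_subalgebra X (cmat.span (Es ` {0, 4}))"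
    unfolding span_Es_0_4 by (rule hadamard_subalgebra_block_algebra[OF parabolic_F])
  ultimately show ?thesis
    by (simp add: index_sets_def Es_0 Es_4)
qed

lemma index_relation_0_4_iff:
  assumes i: "i \<le> 4" "Es i = P \<theta> \<tau>" and j: "j \<le> 4" "Es j = P \<tau> \<theta>"
  shows "(a, b) \<in> index_relation 4 Es {0, 4} \<longleftrightarrow>
    a \<le> 4 \<and> b \<le> 4 \<and> (a = b \<or> {a, b} = {0, 4} \<or> {a, b} = {i, j})"
proof -
  have "hadamard M M' \<in> cmat.span (set (idempotents \<theta> \<tau>))"
    if "M \<in> set (idempotents \<theta> \<tau>)" "M' \<in> set (idempotents \<theta> \<tau>)" for M M'
    using that idempotents_in_algebra hadamard_in_algebra
    unfolding adjacency_algebra_eq_span_idempotents[OF eigenvalues, symmetric] by blast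
  then have "(a, b) \<in> index_relation 4 Es {0, 4} \<longleftrightarrow> a \<le> 4 \<and> b \<le> 4 \<and> linked F (Es a) (Es b)"
    by (simp add: enumerated.index_relation_iff Es_0 Es_4 e\<^sub>0_plus_e\<^sub>F linked_def)
  moreover have "linked F (Es a) (Es b) \<longleftrightarrow> a = b \<or> {a, b} = {0, 4} \<or> {a, b} = {i, j}"
    if "a \<le> 4" "b \<le> 4"
  proof -
    have "{Es a, Es b} = {Es c, Es d} \<longleftrightarrow> {a, b} = {c, d}" if "c \<le> 4" "d \<le> 4" for c d
      using that \<open>a \<le> 4\<close> \<open>b \<le> 4\<close> by (simp add: doubleton_eq_iff enumerated.eq_iff)
    then have "{Es a, Es b} = {e\<^sub>0, e\<^sub>F} \<longleftrightarrow> {a, b} = {0, 4}"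
      "{Es a, Es b} = {P \<theta> \<tau>, P \<tau> \<theta>} \<longleftrightarrow> {a, b} = {i, j}"
      using i j by (simp_all flip: Es_0 Es_4 i(2) j(2))
    then show ?thesis
      using linked_iff[OF eigenvalues enumerated.in_idempotents enumerated.in_idempotents, OF that]
        enumerated.eq_iff[OF that] by (simp only:)
  qed
  ultimately show ?thesis
    by (simp only: cong: conj_cong)
qed

lemma projections_distinct:
  assumes i: "i \<le> 4" "Es i = P \<theta> \<tau>" and j: "j \<le> 4" "Es j = P \<tau> \<theta>"
  shows "i \<noteq> j" "i \<notin> {0, 4}" "j \<notin> {0, 4}"
proof -
  have "P \<theta> \<tau> \<noteq> P \<tau> \<theta>" "P \<theta> \<tau> \<notin> {e\<^sub>0, e\<^sub>F}" "P \<tau> \<theta> \<notin> {e\<^sub>0, e\<^sub>F}"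
    using distinct_idempotents[OF eigenvalues] by (auto simp: idempotents_def)
  then show "i \<noteq> j" "i \<notin> {0, 4}" "j \<notin> {0, 4}"
    unfolding i(2)[symmetric] j(2)[symmetric] Es_0[symmetric] Es_4[symmetric] by (auto intro!: gr0I)
qed

lemma index_relation_projection:
  assumes i: "i \<le> 4" "Es i = P \<theta> \<tau>" and j: "j \<le> 4" "Es j = P \<tau> \<theta>"
  shows "index_relation 4 Es {0, 4} `` {i} = {i, j}"
proof (rule set_eqI)
  show "b \<in> index_relation 4 Es {0, 4} `` {i} \<longleftrightarrow> b \<in> {i, j}" for b
    using i(1) j(1) projections_distinct[OF i j]
    by (auto simp: index_relation_0_4_iff[OF i j] doubleton_eq_iff)
qed

end

section \<open>The Q-Higmanian condition\<close>

context higmanian_scheme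
begin

lemma idempotent_ordering_iff:
  assumes "eigenvalues \<theta> \<tau>"
  shows "idempotent_ordering X d Es \<longleftrightarrow>
    d = 4 \<and> bij_betw Es {..4} (set (idempotents \<theta> \<tau>)) \<and> Es 0 = e\<^sub>0"
  unfolding idempotent_ordering_def primitive_idempotents_eq[OF assms]
  by (auto simp: rank_5 e\<^sub>0_def averaging_matrix_UNIV)

lemma Q_higmanian_if_eigenvalue_ratio:
  assumes eigenvalues: "eigenvalues \<theta> \<tau>" and ratio: "\<theta> = - (real f - 1) * \<tau>"
  shows "Q_higmanian X"
proof -
  define Es where "Es = (!) (idempotents \<theta> \<tau>)"
  have "{..4} = {..<length (idempotents \<theta> \<tau>)}"
    by (auto simp: idempotents_def)
  then have ordering: "bij_betw Es {..4} (set (idempotents \<theta> \<tau>))"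
    unfolding Es_def by (intro bij_betw_nth distinct_idempotents eigenvalues refl)
  have Es: "Es 0 = e\<^sub>0" "Es 1 = P \<theta> \<tau>" "Es 3 = P \<tau> \<theta>" "Es 4 = e\<^sub>F"
    by (simp_all add: Es_def idempotents_def)
  interpret ordered_higmanian_scheme X E F S T f m n k t \<theta> \<tau> Es
    by unfold_locales (fact eigenvalues ordering Es)+
  let ?R = "index_relation 4 Es {0, 4}"
  have "(a, b) \<in> ?R \<longleftrightarrow> a \<le> 4 \<and> b \<le> 4 \<and> (a = b \<or> {a, b} = {0, 4} \<or> {a, b} = {1, 3})" for a b
    using index_relation_0_4_iff[of 1 3 a b] Es by simp
  then have "?R `` {0} = {0, 4}" "?R `` {1} = {1, 3}" "?R `` {2} = {2}" "?R `` {3} = {1, 3}"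
    "?R `` {4} = {0, 4}"
    by (auto simp: doubleton_eq_iff)
  moreover have "{..4::nat} = {0, 1, 2, 3, 4}"
    by auto
  ultimately have "{..4} // ?R = {{0, 4}, {1, 3}, {2}}"
    unfolding quotient_def by auto
  also have "\<dots> = {{i, 4 - i} | i. i < 2} \<union> {{i} | i. 2 \<le> i \<and> i \<le> 4 - 2}"
    by (auto simp: less_2_cases_iff)
  finally have quotient: "{..4} // ?R = {{i, 4 - i} | i. i < 2} \<union> {{i} | i. 2 \<le> i \<and> i \<le> 4 - 2}" .
  have "int (rank (Es (4 - i))) = (int f - 1) * int (rank (Es i))" if "i < 2" for i
    using that rank_e rank_P_ratio_iff[OF eigenvalues] ratio f_ge_2
    by (auto simp: less_2_cases_iff Es[simplified] of_nat_diff)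
  then have "\<forall>i<2. int (rank (Es (4 - i))) =
      (int (card (UNIV // index_parabolic X Es {0, 4})) - 1) * int (rank (Es i))"
    by (simp add: index_parabolic_0_4 card_quotients)
  then show ?thesis
    unfolding Q_higmanian_def
    using commutative idempotent_ordering_iff[OF eigenvalues, of 4 Es] ordering Es_0 index_sets_0_4
      quotient
    by (intro conjI exI[of _ 4] exI[of _ Es] exI[of _ 2]) simp_all
qed

lemma P_entries_distinct:
  assumes "eigenvalues \<theta> \<tau>" "(\<alpha>, \<beta>) \<in> E - Id" "(\<gamma>, \<delta>) \<in> F - E"
  shows "P \<theta> \<tau> $ \<alpha> $ \<alpha> \<noteq> P \<theta> \<tau> $ \<alpha> $ \<beta>" "P \<theta> \<tau> $ \<alpha> $ \<alpha> \<noteq> P \<theta> \<tau> $ \<gamma> $ \<delta>"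
    "P \<theta> \<tau> $ \<alpha> $ \<beta> \<noteq> P \<theta> \<tau> $ \<gamma> $ \<delta>"
proof -
  define c :: complex where "c = - of_real \<tau> / (of_real \<theta> - of_real \<tau>)"
  have "c \<noteq> 0"
    using assms(1) eigenvalues_nonzero[OF assms(1)] by (simp add: c_def eigenvalues_def)
  have "\<gamma> \<noteq> \<delta>"
    using assms(3) by auto
  then have "P \<theta> \<tau> $ \<alpha> $ \<alpha> = c * (1 - 1 / of_nat n)" "P \<theta> \<tau> $ \<alpha> $ \<beta> = c * (- 1 / of_nat n)"
    "P \<theta> \<tau> $ \<gamma> $ \<delta> = 0"
    using assms(2,3) E_imp_F by (auto simp: P_def spectral_projection_def G_entry N_entry c_def)
  moreover have "c * (1 - 1 / of_nat n) - c * (- 1 / of_nat n) = c"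
    by (simp add: algebra_simps)
  ultimately show "P \<theta> \<tau> $ \<alpha> $ \<alpha> \<noteq> P \<theta> \<tau> $ \<alpha> $ \<beta>" "P \<theta> \<tau> $ \<alpha> $ \<alpha> \<noteq> P \<theta> \<tau> $ \<gamma> $ \<delta>"
    "P \<theta> \<tau> $ \<alpha> $ \<beta> \<noteq> P \<theta> \<tau> $ \<gamma> $ \<delta>"
    using \<open>c \<noteq> 0\<close> by auto
qed

lemma hadamard_subalgebra_imp_eq_e\<^sub>F:
  assumes eigenvalues: "eigenvalues \<theta> \<tau>" and M: "M \<in> set (idempotents \<theta> \<tau>)" "M \<noteq> e\<^sub>0"
    and subalgebra: "hadamard_subalgebra X (cmat.span {e\<^sub>0, M})"
  shows "M = e\<^sub>F"
proof -
  have two_values: "M $ \<alpha> $ \<beta> = M $ \<alpha>' $ \<beta>' \<or> M $ \<alpha> $ \<beta> = M $ \<gamma> $ \<delta> \<or>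
      M $ \<alpha>' $ \<beta>' = M $ \<gamma> $ \<delta>" for \<alpha> \<beta> \<alpha>' \<beta>' \<gamma> \<delta>
    using subalgebra unfolding e\<^sub>0_def averaging_matrix_UNIV
    by (rule hadamard_subalgebra_span_pair_two_values)
  obtain \<alpha> \<beta> where E: "(\<alpha>, \<beta>) \<in> E - Id"
    using relation_nonempty[OF basic_relations(1)] by auto
  obtain \<gamma> \<delta> where F: "(\<gamma>, \<delta>) \<in> F - E"
    using relation_nonempty[OF basic_relations(2)] by auto
  obtain \<epsilon> \<zeta> where outside: "(\<epsilon>, \<zeta>) \<notin> F"
    using F_proper by auto
  have "M \<noteq> P \<theta> \<tau>" if "eigenvalues \<theta> \<tau>" for \<theta> \<tau>
    using P_entries_distinct[OF that E F] two_values by metis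
  moreover have "M \<noteq> e\<^sub>E"
  proof
    assume "M = e\<^sub>E"
    then have "M $ \<alpha> $ \<alpha> = 1 / of_nat n - 1 / (of_nat m * of_nat n)"
      "M $ \<gamma> $ \<delta> = - 1 / (of_nat m * of_nat n)"
      "M $ \<epsilon> $ \<zeta> = 0"
      using F outside E_imp_F by (auto simp: e\<^sub>E_def averaging_matrix_def valency_E valency_F)
    then show False
      using two_values[of \<alpha> \<alpha> \<gamma> \<delta> \<epsilon> \<zeta>] by simp
  qed
  ultimately show ?thesis
    using M eigenvalues eigenvalues_commute by (auto simp: idempotents_def)
qed

lemma Q_higmanian_ordering:
  assumes Q: "Q_higmanian X" and eigenvalues: "eigenvalues \<theta> \<tau>"
  obtains Es l where "ordered_higmanian_scheme X E F S T f m n k t \<theta> \<tau> Es" "l \<le> 2"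
    "{..4} // index_relation 4 Es {0, 4} = {{i, 4 - i} | i. i < l} \<union> {{i} | i. l \<le> i \<and> i \<le> 4 - l}"
    "\<forall>i<l. int (rank (Es (4 - i))) =
      (int (card (UNIV // index_parabolic X Es {0, 4})) - 1) * int (rank (Es i))"
proof -
  obtain d Es l where "idempotent_ordering X d Es" and l: "2 * l \<le> d"
    and index_set: "{0, d} \<in> index_sets X d Es"
    and quotient: "{..d} // index_relation d Es {0, d} =
      {{i, d - i} | i. i < l} \<union> {{i} | i. l \<le> i \<and> i \<le> d - l}"
    and ranks: "\<forall>i<l. int (rank (Es (d - i))) =
      (int (card (UNIV // index_parabolic X Es {0, d})) - 1) * int (rank (Es i))"
    using Q unfolding Q_higmanian_def by (elim conjE exE) (rule that; assumption)
  then have d: "d = 4" and ordering: "bij_betw Es {..4} (set (idempotents \<theta> \<tau>))"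
    and Es_0: "Es 0 = e\<^sub>0"
    by (simp_all add: idempotent_ordering_iff[OF eigenvalues])
  have "Es 4 \<noteq> e\<^sub>0" "Es 4 \<in> set (idempotents \<theta> \<tau>)"
    using Es_0 inj_onD[OF bij_betw_imp_inj_on[OF ordering], of 4 0] bij_betwE[OF ordering] by auto
  moreover have "hadamard_subalgebra X (cmat.span {e\<^sub>0, Es 4})"
    using index_set by (simp add: index_sets_def Es_0 d)
  ultimately have Es_4: "Es 4 = e\<^sub>F"
    using hadamard_subalgebra_imp_eq_e\<^sub>F[OF eigenvalues] by blast
  have "ordered_higmanian_scheme X E F S T f m n k t \<theta> \<tau> Es"
    by unfold_locales (fact eigenvalues ordering Es_0 Es_4)+
  then show thesis
    using that l quotient ranks by (simp add: d)
qed

text \<open>The two projections of \<open>G\<close> form a class of \<open>\<sim>\<^sub>I\<close>, which the ordering forces to be \<open>{1, 3}\<close>.\<close>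

lemma eigenvalue_ratio_if_Q_higmanian:
  assumes Q: "Q_higmanian X" and eigenvalues: "eigenvalues \<theta> \<tau>"
  shows "\<theta> = - (real f - 1) * \<tau> \<or> \<tau> = - (real f - 1) * \<theta>"
proof -
  obtain Es l where "ordered_higmanian_scheme X E F S T f m n k t \<theta> \<tau> Es" and l: "l \<le> 2"
    and quotient: "{..4} // index_relation 4 Es {0, 4} =
      {{i, 4 - i} | i. i < l} \<union> {{i} | i. l \<le> i \<and> i \<le> 4 - l}"
    and ranks: "\<forall>i<l. int (rank (Es (4 - i))) =
      (int (card (UNIV // index_parabolic X Es {0, 4})) - 1) * int (rank (Es i))"
    using Q_higmanian_ordering[OF Q eigenvalues] .
  then interpret ordered_higmanian_scheme X E F S T f m n k t \<theta> \<tau> Es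
    by blast
  have "P \<theta> \<tau> \<in> Es ` {..4}" "P \<tau> \<theta> \<in> Es ` {..4}"
    unfolding bij_betw_imp_surj_on[OF ordering] by (simp_all add: idempotents_def)
  then obtain i j where i: "i \<le> 4" "Es i = P \<theta> \<tau>" and j: "j \<le> 4" "Es j = P \<tau> \<theta>"
    by (elim imageE) simp
  have "i \<noteq> j" "i \<notin> {0, 4}" "j \<notin> {0, 4}"
    using projections_distinct[OF i j] .
  have "{i, j} \<in> {..4} // index_relation 4 Es {0, 4}"
    using quotientI[of i "{..4}" "index_relation 4 Es {0, 4}"] i(1)
    by (simp add: index_relation_projection[OF i j])
  then obtain a where a: "a < l" "{i, j} = {a, 4 - a}"
    unfolding quotient using \<open>i \<noteq> j\<close> by (auto simp: doubleton_eq_iff)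
  have "a = 1"
    using a \<open>i \<notin> {0, 4}\<close> l by (cases "a = 0") (auto simp: doubleton_eq_iff)
  then have "i = 1 \<and> j = 3 \<or> i = 3 \<and> j = 1"
    using a(2) by (auto simp: doubleton_eq_iff)
  moreover have "int (rank (Es 3)) = (int f - 1) * int (rank (Es 1))"
    using ranks[rule_format, OF a(1)] \<open>a = 1\<close> by (simp add: index_parabolic_0_4 card_quotients)
  ultimately show ?thesis
    using i(2) j(2) rank_P_ratio_iff[OF eigenvalues]
      rank_P_ratio_iff[OF eigenvalues_commute[OF eigenvalues]]
    by auto
qed

end

lemma root_ratio_iff_root_sum:
  fixes c w \<theta> \<tau> :: real
  assumes product: "\<theta> * \<tau> = - (c * w\<^sup>2)" and "c \<noteq> 0"
  shows "\<theta> = - c * \<tau> \<or> \<tau> = - c * \<theta> \<longleftrightarrow> (\<exists>\<epsilon>\<in>{1, -1}. \<theta> + \<tau> = \<epsilon> * (c - 1) * w)"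
proof -
  have "(\<theta> + c * \<tau>) * (\<tau> + c * \<theta>) = c * ((\<theta> + \<tau>)\<^sup>2 - ((c - 1) * w)\<^sup>2)"
    using product by algebra
  then have "(\<theta> + c * \<tau>) * (\<tau> + c * \<theta>) = 0 \<longleftrightarrow> (\<theta> + \<tau>)\<^sup>2 = ((c - 1) * w)\<^sup>2"
    using \<open>c \<noteq> 0\<close> by simp
  moreover have "\<theta> + \<tau> = \<epsilon> * (c - 1) * w \<longleftrightarrow> \<theta> + \<tau> = \<epsilon> * ((c - 1) * w)" for \<epsilon>
    by (simp only: mult.assoc)
  ultimately show ?thesis
    by (simp add: power2_eq_iff add_eq_0_iff2)
qed

context higmanian_scheme
begin

lemma t_formula_iff:
  "real t = real k * (real f - 2) / (real m * real n) *
      (real m * real n - real k + \<epsilon> * eigenvalue_scale) \<longleftrightarrow>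
    eigenvalue_sum = \<epsilon> * (real f - 2) * eigenvalue_scale"
proof -
  define q where "q = real k / (real m * real n)"
  have "q \<noteq> 0"
    by (simp add: q_def)
  have "real t = q * ((real f - 2) * (real m * real n - real k) + eigenvalue_sum)"
    by (simp add: eigenvalue_sum_def q_def)
  moreover have "real k * (real f - 2) / (real m * real n) *
      (real m * real n - real k + \<epsilon> * eigenvalue_scale) =
      q * ((real f - 2) * (real m * real n - real k) + \<epsilon> * (real f - 2) * eigenvalue_scale)"
    by (simp add: q_def algebra_simps add_divide_distrib diff_divide_distrib)
  ultimately show ?thesis
    using \<open>q \<noteq> 0\<close> by simp
qed

lemma Q_higmanian_iff:
  "Q_higmanian X \<longleftrightarrow> (\<exists>\<epsilon>\<in>{1, -1 :: real}. real t = real k * (real f - 2) / (real m * real n) *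
     (real m * real n - real k + \<epsilon> * eigenvalue_scale))"
proof -
  obtain \<theta> \<tau> where eigenvalues: "eigenvalues \<theta> \<tau>"
    using eigenvalues_exist .
  have "Q_higmanian X \<longleftrightarrow> \<theta> = - (real f - 1) * \<tau> \<or> \<tau> = - (real f - 1) * \<theta>"
    using eigenvalue_ratio_if_Q_higmanian[OF _ eigenvalues]
      Q_higmanian_if_eigenvalue_ratio[OF eigenvalues]
      Q_higmanian_if_eigenvalue_ratio[OF eigenvalues_commute[OF eigenvalues]] by blast
  also have "\<dots> \<longleftrightarrow> (\<exists>\<epsilon>\<in>{1, -1}. \<theta> + \<tau> = \<epsilon> * (real f - 1 - 1) * eigenvalue_scale)"
    using eigenvalues f_ge_2 by (intro root_ratio_iff_root_sum) (auto simp: eigenvalues_def)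
  also have "\<theta> + \<tau> = eigenvalue_sum"
    using eigenvalues by (simp add: eigenvalues_def)
  finally show ?thesis
    by (simp only: t_formula_iff) simp
qed

end

section \<open>The relations of a Higmanian scheme\<close>

context scheme
begin

lemma relations_within_nested_parabolics:
  assumes E: "parabolic UNIV X E" and F: "parabolic UNIV X F" and "E \<subset> F" and "E \<noteq> Id"
    and rank: "card {R \<in> X. R \<subseteq> F} = 3"
  shows "{R \<in> X. R \<subseteq> F} = {Id, E - Id, F - E}"
proof -
  define inside where "inside P = {R \<in> X. R \<subseteq> P}" for P
  have Union_inside: "\<Union>(inside E) = E" "\<Union>(inside F) = F"
    using parabolic_Union_eq[OF E] parabolic_Union_eq[OF F] by (simp_all add: inside_def)
  have "inside E \<noteq> inside F"
    using \<open>E \<subset> F\<close> Union_inside by (metis less_irrefl)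
  moreover have subset: "inside E \<subseteq> inside F"
    using \<open>E \<subset> F\<close> by (auto simp: inside_def)
  ultimately obtain Q where Q: "Q \<in> inside F" "Q \<notin> inside E"
    by blast
  have Id: "Id \<in> inside E"
    using Id_in_relations E by (auto simp: inside_def parabolic_def equiv_def refl_on_def)
  moreover have "inside E \<noteq> {Id}"
    using Union_inside(1) \<open>E \<noteq> Id\<close> by (metis cSup_singleton)
  ultimately obtain R where R: "R \<in> inside E" "R \<noteq> Id"
    by blast
  have "{Id, R, Q} \<subseteq> inside F" "card {Id, R, Q} = 3"
    using Id subset R Q by (auto simp: card_insert_if)
  moreover have "finite (inside F)" "card (inside F) = 3"
    using rank by (simp_all add: inside_def card_ge_0_finite)
  ultimately have inside_F: "inside F = {Id, R, Q}"
    using card_subset_eq[of "inside F" "{Id, R, Q}"] by simp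
  then have inside_E: "inside E = {Id, R}"
    using Id subset R Q by blast
  have "R \<inter> Id = {}"
    using relation_eqI[of R Id] R Id_in_relations by (auto simp: inside_def)
  then have "E - Id = R"
    using Union_inside(1)[unfolded inside_E] by auto
  moreover have "Q \<inter> E = {}"
    using parabolic_relation_cases[OF E, of Q] Q by (auto simp: inside_def)
  then have "F - E = Q"
    using Union_inside[unfolded inside_F inside_E] by auto
  ultimately show ?thesis
    using inside_F by (simp add: inside_def)
qed

lemma nested_parabolics_relations:
  assumes "parabolic UNIV X E" "parabolic UNIV X F" "E \<subset> F" "E \<noteq> Id"
    and rank: "card X = 5" and outside: "{R \<in> X. \<not> R \<subseteq> F} = {S, T}" and "S \<noteq> T"
  shows "X = {Id, E - Id, F - E, S, T}"
proof -
  have X_split: "X = {R \<in> X. R \<subseteq> F} \<union> {S, T}" "{R \<in> X. R \<subseteq> F} \<inter> {S, T} = {}"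
    using outside by blast+
  have "finite {R \<in> X. R \<subseteq> F}"
    using rank by (simp add: card_ge_0_finite)
  then have "card X = card {R \<in> X. R \<subseteq> F} + card {S, T}"
    by (subst X_split(1), intro card_Un_disjoint X_split(2)) simp_all
  then have "{R \<in> X. R \<subseteq> F} = {Id, E - Id, F - E}"
    using rank \<open>S \<noteq> T\<close> by (intro relations_within_nested_parabolics assms) simp
  then show ?thesis
    using X_split(1) by auto
qed

lemma relations_outside_parabolic:
  assumes F: "parabolic UNIV X F" and outside: "{R \<in> X. \<not> R \<subseteq> F} = Y"
  shows "\<Union>Y = - F"
proof -
  have "R \<inter> F = {}" if "R \<in> Y" for R
    using that parabolic_relation_cases[OF F, of R] outside by auto
  then have "F \<inter> \<Union>Y = {}"
    by blast
  have "UNIV = \<Union>({R \<in> X. R \<subseteq> F} \<union> {R \<in> X. \<not> R \<subseteq> F})"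
    unfolding Union_relations[symmetric] by (rule arg_cong[of _ _ Union]) blast
  also have "\<dots> = F \<union> \<Union>Y"
    by (simp only: Union_Un_distrib parabolic_Union_eq[OF F] outside)
  finally show ?thesis
    using compl_unique[OF \<open>F \<inter> \<Union>Y = {}\<close>] by simp
qed

end

lemma higmanian_schemeI:
  fixes X :: "('n::finite \<times> 'n) set set"
  assumes "higmanian UNIV X" "higmanian_parameters UNIV X f m n k t" "f \<ge> 2" "m \<ge> 2" "n \<ge> 2"
  obtains E F S T where "higmanian_scheme X E F S T f m n k t"
proof -
  have X: "symmetric_scheme UNIV X" "\<not> decomposable UNIV X" "card X = 5"
    using assms(1) by (auto simp: higmanian_def)
  obtain E F S T where sub: "E \<subset> F"
    and parabolics: "{P. proper_nontrivial_parabolic UNIV X P} = {E, F}"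
    and ST: "S \<noteq> T" "{R \<in> X. \<not> R \<subseteq> F} = {S, T}"
    and f: "real f = real CARD('n) / real (valency UNIV F)"
    and m: "real m = real (valency UNIV F) / real (valency UNIV E)"
    and n: "n = valency UNIV E"
    and k: "k = (THE k. \<forall>\<alpha>\<in>UNIV. \<forall>\<Delta>\<in>UNIV // F. \<alpha> \<notin> \<Delta> \<longrightarrow> card {\<beta>\<in>\<Delta>. (\<alpha>, \<beta>) \<in> S} = k)"
    and t: "t = intersection_number T S T"
    using assms(2) unfolding higmanian_parameters_def by (elim exE conjE) (rule that; assumption)
  interpret sym_scheme X
    by unfold_locales (rule X(1))
  have "proper_nontrivial_parabolic UNIV X E" "proper_nontrivial_parabolic UNIV X F"
    using parabolics by blast+
  moreover have "Id_on (UNIV :: 'n set) = Id"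
    by auto
  ultimately have EF: "parabolic UNIV X E" "parabolic UNIV X F" "E \<noteq> Id" "F \<noteq> UNIV"
    by (simp_all add: proper_nontrivial_parabolic_def)
  have valency_F: "valency UNIV F = m * n"
    using m n assms(5) by (simp add: field_simps flip: of_nat_mult)
  have "CARD('n) = f * m * n"
    using f valency_F assms(4,5) by (simp add: field_simps flip: of_nat_mult)
  moreover have "S \<union> T = - F"
    using relations_outside_parabolic[OF EF(2) ST(2)] by simp
  ultimately have "higmanian_scheme X E F S T f m n k t"
    using nested_parabolics_relations[OF EF(1,2) sub EF(3) X(3) ST(2,1)]
    by unfold_locales (use X EF sub ST n valency_F assms(3-5) k t in auto)
  then show thesis
    by (rule that)
qed

theorem theorem2:
  fixes X :: "('a::finite \<times> 'a) set set" and f m n k t :: nat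
  assumes "higmanian UNIV X"
    and "higmanian_parameters UNIV X f m n k t"
    and "f \<ge> 2" and "m \<ge> 2" and "n \<ge> 2"
  shows "Q_higmanian X \<longleftrightarrow>
    (\<exists>\<epsilon>\<in>{1, -1 :: real}.
       real t = real k * (real f - 2) / (real m * real n) *
         (real m * real n - real k +
          \<epsilon> * sqrt (real k * (real m * real n - real k) / (real m * (real n - 1)))))"
proof -
  obtain E F S T where "higmanian_scheme X E F S T f m n k t"
    using higmanian_schemeI[OF assms] .
  then interpret higmanian_scheme X E F S T f m n k t .
  show ?thesis
    using Q_higmanian_iff unfolding eigenvalue_scale_def .
qed

end
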